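(* Let $1\le\ell_1\le\dots\le\ell_r\le n$ and $T=C_r\otimes\cdots\otimes C_1\in B(\varpi_{\ell_r})\otimes\cdots\otimes B(\varpi_{\ell_1})$. (a) If $T$ is not semistandard then $\Psi_T=0$. (b) If $T$ is highest weight, of shape $\lambda=\sum_{i=1}^r\varpi_{\ell_i}$, then $\Psi_T=\mathbf 1_\lambda$. (c) Let $\mu\in(\mathbb Z^n_{\ge0})_+$ with $\ell(\mu)\le\ell_1$ and suppose $T\otimes T^0_\mu$ is semistandard. Let $j\in[n-1]$ with $j\notin C_1$ and $j+1\in C_1$. Then, writing $\Sigma=\sum_{1\le k<r,\ \sigma^j_{C_k}\sigma^j_{C_{k+1}}=-1}\sigma^j_{C_k}(1-t)\Psi_{\Omega^j_k(T)\otimes T^0_\mu}$, $$\Psi_{T\otimes T^0_\mu}=\begin{cases}T_j\,\Psi_{\Omega^j_r(T)\otimes T^0_\mu}+\Sigma, & \text{if } j\in C_r,\ j+1\notin C_r,\\ tT_j^{-1}\,\Psi_{\Omega^j_r(T)\otimes T^0_\mu}+\Sigma, & \text{otherwise.}\end{cases}$$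
   Context: Fix $n\ge1$, $[n]=\{1,\dots,n\}$. $S_n$ is the symmetric group with simple transpositions $s_i=(i,i+1)$ and length function $\ell(\cdot)$. $S_n$ acts on $\mathbb Z^n$ by permuting coordinates; $\varepsilon_1,\dots,\varepsilon_n$ is the standard basis, $\varpi_k=\varepsilon_1+\dots+\varepsilon_k$. $(\mathbb Z^n_{\ge0})_+=\{\lambda\in\mathbb Z^n_{\ge0}:\lambda_1\ge\dots\ge\lambda_n\}$; $\ell(\mu)$ is the number of nonzero parts of $\mu$. For $\lambda\in\mathbb Z^n$, $S_{n,\lambda}=\{w:w\lambda=\lambda\}$. The affine Hecke algebra $H$ is the $\mathbb Z[t^{\pm1}]$-algebra with generators $T_1,\dots,T_{n-1},X_1^{\pm1},\dots,X_n^{\pm1}$ and relations $T_i^2=(t-1)T_i+t$, $T_iT_{i+1}T_i=T_{i+1}T_iT_{i+1}$, $T_iT_j=T_jT_i$ for $|i-j|>1$, $X_iX_j=X_jX_i$, $T_iX_iT_i=tX_{i+1}$, $T_iX_j=X_jT_i$ for $j\notin\{i,i+1\}$ ($tT_i^{-1}=T_i+1-t$). $T_w=T_{i_1}\cdots T_{i_m}$ for a reduced expression $w=s_{i_1}\cdots s_{i_m}$. $H_n$ is the subalgebra generated by the $T_i$ (basis $\{T_w\}_{w\in S_n}$); $H_{n,\lambda}$ is the span of $\{T_w:w\in S_{n,\lambda}\}$, and $\mathbf 1_\lambda=\sum_{w\in S_{n,\lambda}}T_w$. Columns: a column of length $\ell$ is $C=(c_1<\dots<c_\ell)\subseteq[n]$;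 $B(\varpi_\ell)$ is their set. $u_C\in S_n$ sends $k\mapsto c_k$ ($k\le\ell$) and sends $\ell+1,\dots,n$ increasingly onto $[n]\setminus C$. $s_jC$ is the column whose underlying set is the image of $C$ under the transposition $(j,j+1)$. $\sigma^j_C=-1$ if $j\in C$, $j+1\notin C$, and $\sigma^j_C=+1$ otherwise. The column $(1,\dots,\ell)$ is highest weight. Tableaux: for $1\le\ell_1\le\dots\le\ell_r\le n$, $B(\varpi_{\ell_r})\otimes\cdots\otimes B(\varpi_{\ell_1})$ is the set of $T=C_r\otimes\cdots\otimes C_1$, $C_i\in B(\varpi_{\ell_i})$, viewed as a filling of the Young diagram of $\sum\varpi_{\ell_i}$ with columns $C_r,\dots,C_1$ from left to right; $T$ is semistandard if rows weakly increase left to right, and highest weight if all its columns are highest weight. Concatenation $T\otimes T'$ is defined when every column of $T$ is at least as long as every column of $T'$. For $\mu\in(\mathbb Z^n_{\ge0})_+$, $T^0_\mu$ is the tableau of shape $\mu$ all of whose columns are highest weight (row $i$ filled with $i$); $T^0_0$ is empty. For $k\in[r]$, $\Omega^j_k(T)=C_r\otimes\cdots\otimes C_{k+1}\otimes s_jC_k\otimes\cdots\otimes s_jC_1$. Definition of $\Psi$: every $h\in H_n$ is uniquely $h=\sum_{F\in B(\varpi_\ell)}T_{u_F}h_F$ with $h_F\in H_{n,\varpi_\ell}$. For a column $C\in B(\varpi_\ell)$, $\Psi_C=t^{\ell(u_C)}(T_{u_C^{-1}})^{-1}\mathbf 1_{\varpi_\ell}$; for $T=C\otimes S$ with $C\in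 B(\varpi_\ell)$, $S$ a tensor of columns of lengths $\le\ell$, write $\Psi_S=\sum_{E\in B(\varpi_\ell)}T_{u_E}h_{E,S}$ with $h_{E,S}\in H_{n,\varpi_\ell}$, and set $\Psi_T=t^{\ell(u_C)}(T_{u_C^{-1}})^{-1}h_{C,S}$. *)

theory Defs
  imports "HOL-Combinatorics.Combinatorics"
begin

definition perms :: "nat \<Rightarrow> (nat \<Rightarrow> nat) set" where
  "perms n = {w. w permutes {1..n}}"

definition len :: "nat \<Rightarrow> (nat \<Rightarrow> nat) \<Rightarrow> nat" where
  "len n w = card {(i, j). i \<in> {1..n} \<and> j \<in> {1..n} \<and> i < j \<and> w j < w i}"

definition sgen :: "nat \<Rightarrow> nat \<Rightarrow> nat" where
  "sgen i = Transposition.transpose i (Suc i)"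

text \<open>Elements of the finite Hecke algebra H_n over a commutative ring with a unit t:
  coefficient functions on S_n (the coefficient of T_w), zero outside S_n.\<close>

type_synonym 'a hecke = "(nat \<Rightarrow> nat) \<Rightarrow> 'a"

definition hecke :: "nat \<Rightarrow> 'a::comm_ring_1 hecke set" where
  "hecke n = {h. \<forall>w. w \<notin> perms n \<longrightarrow> h w = 0}"

definition hzero :: "'a::comm_ring_1 hecke" where
  "hzero = (\<lambda>_. 0)"

definition hbasis :: "(nat \<Rightarrow> nat) \<Rightarrow> 'a::comm_ring_1 hecke" where
  "hbasis w = (\<lambda>v. if v = w then 1 else 0)"

definition hone :: "'a::comm_ring_1 hecke" where
  "hone = hbasis id"

definition hadd :: "'a::comm_ring_1 hecke \<Rightarrow> 'a hecke \<Rightarrow> 'a hecke" where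
  "hadd h g = (\<lambda>w. h w + g w)"

definition hscale :: "'a::comm_ring_1 \<Rightarrow> 'a hecke \<Rightarrow> 'a hecke" where
  "hscale c h = (\<lambda>w. c * h w)"

definition hsum :: "('b \<Rightarrow> 'a::comm_ring_1 hecke) \<Rightarrow> 'b set \<Rightarrow> 'a hecke" where
  "hsum f A = (\<lambda>v. \<Sum>x\<in>A. f x v)"

text \<open>Left multiplication by the generator T_i:
  T_i T_w = T_{s_i w} if l(s_i w) > l(w), and (t-1) T_w + t T_{s_i w} otherwise.\<close>

definition hgen_mult :: "'a::comm_ring_1 \<Rightarrow> nat \<Rightarrow> nat \<Rightarrow> 'a hecke \<Rightarrow> 'a hecke" where
  "hgen_mult t n i h = (\<lambda>v. if v \<in> perms n then
      (if len n (sgen i \<circ> v) < len n v then h (sgen i \<circ> v) + (t - 1) * h v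
       else t * h (sgen i \<circ> v))
    else 0)"

definition reduced_word :: "nat \<Rightarrow> (nat \<Rightarrow> nat) \<Rightarrow> nat list \<Rightarrow> bool" where
  "reduced_word n w is \<longleftrightarrow> set is \<subseteq> {1..<n} \<and> w = foldr (\<lambda>i acc. sgen i \<circ> acc) is id
     \<and> length is = len n w"

definition hbasis_mult :: "'a::comm_ring_1 \<Rightarrow> nat \<Rightarrow> (nat \<Rightarrow> nat) \<Rightarrow> 'a hecke \<Rightarrow> 'a hecke" where
  "hbasis_mult t n w g = foldr (hgen_mult t n) (SOME is. reduced_word n w is) g"

definition hmult :: "'a::comm_ring_1 \<Rightarrow> nat \<Rightarrow> 'a hecke \<Rightarrow> 'a hecke \<Rightarrow> 'a hecke" where
  "hmult t n h g = (\<lambda>v. \<Sum>w\<in>perms n. h w * hbasis_mult t n w g v)"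

definition hinv :: "'a::comm_ring_1 \<Rightarrow> nat \<Rightarrow> 'a hecke \<Rightarrow> 'a hecke" where
  "hinv t n h = (THE g. g \<in> hecke n \<and> hmult t n h g = hone \<and> hmult t n g h = hone)"

definition stab :: "nat \<Rightarrow> (nat \<Rightarrow> int) \<Rightarrow> (nat \<Rightarrow> nat) set" where
  "stab n lam = {w \<in> perms n. \<forall>i\<in>{1..n}. lam (w i) = lam i}"

definition hpar :: "nat \<Rightarrow> (nat \<Rightarrow> int) \<Rightarrow> 'a::comm_ring_1 hecke set" where
  "hpar n lam = {h \<in> hecke n. \<forall>w. w \<notin> stab n lam \<longrightarrow> h w = 0}"

definition one_lam :: "nat \<Rightarrow> (nat \<Rightarrow> int) \<Rightarrow> 'a::comm_ring_1 hecke" where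
  "one_lam n lam = (\<lambda>w. if w \<in> stab n lam then 1 else 0)"

definition varpi :: "nat \<Rightarrow> nat \<Rightarrow> int" where
  "varpi l = (\<lambda>i. if i \<le> l then 1 else 0)"

definition cols :: "nat \<Rightarrow> nat \<Rightarrow> nat set set" where
  "cols n l = {C. C \<subseteq> {1..n} \<and> card C = l}"

definition entry :: "nat set \<Rightarrow> nat \<Rightarrow> nat" where
  "entry C k = sorted_list_of_set C ! (k - 1)"

definition uC :: "nat \<Rightarrow> nat set \<Rightarrow> nat \<Rightarrow> nat" where
  "uC n C = (\<lambda>k. if k \<in> {1..card C} then entry C k
     else if k \<in> {Suc (card C)..n} then sorted_list_of_set ({1..n} - C) ! (k - Suc (card C))
     else k)"

definition component :: "'a::comm_ring_1 \<Rightarrow> nat \<Rightarrow> nat \<Rightarrow> 'a hecke \<Rightarrow> nat set \<Rightarrow> 'a hecke" where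
  "component t n l h = (THE f. (\<forall>F\<in>cols n l. f F \<in> hpar n (varpi l))
      \<and> (\<forall>F. F \<notin> cols n l \<longrightarrow> f F = hzero)
      \<and> h = hsum (\<lambda>F. hmult t n (hbasis (uC n F)) (f F)) (cols n l))"

text \<open>Tensors of columns C_r (x) ... (x) C_1 as lists [C_r, ..., C_1] (left to right).\<close>

fun Psi :: "'a::comm_ring_1 \<Rightarrow> nat \<Rightarrow> nat set list \<Rightarrow> 'a hecke" where
  "Psi t n [] = hone"
| "Psi t n [C] = hscale (t ^ len n (uC n C))
     (hmult t n (hinv t n (hbasis (inv (uC n C)))) (one_lam n (varpi (card C))))"
| "Psi t n (C # D # S) = hscale (t ^ len n (uC n C))
     (hmult t n (hinv t n (hbasis (inv (uC n C)))) (component t n (card C) (Psi t n (D # S)) C))"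

definition is_tab :: "nat \<Rightarrow> nat set list \<Rightarrow> bool" where
  "is_tab n T \<longleftrightarrow> T \<noteq> [] \<and> (\<forall>C\<in>set T. C \<subseteq> {1..n} \<and> 1 \<le> card C)
     \<and> sorted_wrt (\<lambda>C D. card D \<le> card C) T"

definition semistandard :: "nat set list \<Rightarrow> bool" where
  "semistandard T \<longleftrightarrow> (\<forall>i. Suc i < length T \<longrightarrow>
      (\<forall>k\<in>{1..card (T ! Suc i)}. entry (T ! i) k \<le> entry (T ! Suc i) k))"

definition highest_weight :: "nat set list \<Rightarrow> bool" where
  "highest_weight T \<longleftrightarrow> (\<forall>C\<in>set T. C = {1..card C})"

text \<open>Shape sum_i varpi_{l_i}: its i-th part is the number of columns of length >= i.\<close>

definition shape :: "nat set list \<Rightarrow> nat \<Rightarrow> int" where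
  "shape T = (\<lambda>i. int (length (filter (\<lambda>C. i \<le> card C) T)))"

definition sigma :: "nat \<Rightarrow> nat set \<Rightarrow> int" where
  "sigma j C = (if j \<in> C \<and> Suc j \<notin> C then -1 else 1)"

definition scol :: "nat \<Rightarrow> nat set \<Rightarrow> nat set" where
  "scol j C = Transposition.transpose j (Suc j) ` C"

definition colk :: "nat set list \<Rightarrow> nat \<Rightarrow> nat set" where
  "colk T k = T ! (length T - k)"

definition Omega :: "nat \<Rightarrow> nat \<Rightarrow> nat set list \<Rightarrow> nat set list" where
  "Omega j k T = take (length T - k) T @ map (scol j) (drop (length T - k) T)"

definition is_partition :: "nat \<Rightarrow> (nat \<Rightarrow> nat) \<Rightarrow> bool" where
  "is_partition n mu \<longleftrightarrow> (\<forall>i\<in>{1..n}. \<forall>j\<in>{1..n}. i \<le> j \<longrightarrow> mu j \<le> mu i)"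

definition nparts :: "nat \<Rightarrow> (nat \<Rightarrow> nat) \<Rightarrow> nat" where
  "nparts n mu = card {i \<in> {1..n}. mu i \<noteq> 0}"

definition T0 :: "nat \<Rightarrow> (nat \<Rightarrow> nat) \<Rightarrow> nat set list" where
  "T0 n mu = map (\<lambda>c. {1..card {i \<in> {1..n}. c \<le> mu i}}) [1..<Suc (mu 1)]"

end

theory Submission
  imports Defs "HOL-Library.Function_Algebras"
begin

text \<open>
  The bar version of \<open>T\<^sub>j\<close> is \<open>t T\<^sub>j\<^sup>-\<^sup>1 = T\<^sub>j + 1 - t\<close>. \<open>\<Psi>\<close> is built by iterating the column
  operators \<open>h \<mapsto> t\<^bsup>l(u)\<^esup> T\<^bsub>inv u\<^esub>\<^sup>-\<^sup>1 h\<^sub>C\<close>, where \<open>u = u\<^sub>C\<close> and \<open>h\<^sub>C\<close> is the component of \<open>h\<close> at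
  \<open>C\<close>. Such an operator intertwines multiplication by \<open>T\<^sub>j\<close> (if \<open>\<sigma>\<^sub>C = -1\<close>) or by its bar version
  (if \<open>\<sigma>\<^sub>C = 1\<close>) with the reflection \<open>C \<mapsto> s\<^sub>jC\<close>, and a change of sign between neighbouring columns
  costs a multiple of \<open>1 - t\<close>. This gives (c) by induction on the number of columns, for every
  starting vector fixed by the bar version of \<open>T\<^sub>j\<close>; semistandardness enters only to show that
  \<open>s\<^sub>j\<close> stabilises \<open>\<mu>\<close>.
  For (a), the values of the operator of a column \<open>D\<close> of length \<open>m\<close> are supported on permutations
  \<open>w\<close> for which \<open>w{1..m}\<close> is below \<open>D\<close> in the Gale order, so their components at \<open>C\<close> vanish unless
  the rows of \<open>C \<otimes> D\<close> increase weakly.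
\<close>

declare One_nat_def [simp del]

section \<open>Permutations, descents and length\<close>

lemma perms_bij: "w \<in> perms n \<Longrightarrow> bij w"
  by (auto simp: perms_def permutes_bij)

lemma perms_inj: "w \<in> perms n \<Longrightarrow> inj w"
  by (simp add: perms_bij bij_is_inj)

lemma perms_apply_inv: "w \<in> perms n \<Longrightarrow> w (inv w x) = x"
  by (auto simp: perms_def permutes_inverses)

lemma perms_inv_apply: "w \<in> perms n \<Longrightarrow> inv w (w x) = x"
  by (auto simp: perms_def permutes_inverses)

lemma perms_comp_inv: "w \<in> perms n \<Longrightarrow> w \<circ> inv w = id"
  by (auto simp: perms_def permutes_inv_o)

lemma perms_inv_comp: "w \<in> perms n \<Longrightarrow> inv w \<circ> w = id"
  by (auto simp: perms_def permutes_inv_o)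

lemma inv_inv_perms: "w \<in> perms n \<Longrightarrow> inv (inv w) = w"
  by (simp add: perms_bij inv_inv_eq)

lemma inv_comp_perms: "v \<in> perms n \<Longrightarrow> w \<in> perms n \<Longrightarrow> inv (v \<circ> w) = inv w \<circ> inv v"
  by (simp add: o_inv_distrib perms_bij)

lemma perms_in_range_iff: "w \<in> perms n \<Longrightarrow> w x \<in> {1..n} \<longleftrightarrow> x \<in> {1..n}"
  unfolding perms_def mem_Collect_eq by (rule permutes_in_image)

lemma perms_fixes_outside: "w \<in> perms n \<Longrightarrow> x \<notin> {1..n} \<Longrightarrow> w x = x"
  by (auto simp: perms_def permutes_not_in)

lemma perms_image: "w \<in> perms n \<Longrightarrow> w ` {1..n} = {1..n}"
  by (simp add: perms_def permutes_image)

lemma finite_perms [simp]: "finite (perms n)"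
  by (simp add: perms_def finite_permutations)

lemma id_in_perms [simp]: "id \<in> perms n"
  by (simp add: perms_def permutes_id)

lemma comp_in_perms: "v \<in> perms n \<Longrightarrow> w \<in> perms n \<Longrightarrow> v \<circ> w \<in> perms n"
  by (simp add: perms_def permutes_compose)

lemma inv_in_perms [simp]: "w \<in> perms n \<Longrightarrow> inv w \<in> perms n"
  by (simp add: perms_def permutes_inv)

lemma inv_comp_in_perms_iff:
  assumes "u \<in> perms n" shows "inv u \<circ> w \<in> perms n \<longleftrightarrow> w \<in> perms n"
proof
  assume "inv u \<circ> w \<in> perms n"
  then have "u \<circ> (inv u \<circ> w) \<in> perms n" using assms by (rule comp_in_perms[rotated])
  then show "w \<in> perms n" by (simp add: o_assoc perms_comp_inv[OF assms])
qed (simp add: assms comp_in_perms)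

lemma sgen_apply: "sgen i x = (if x = i then Suc i else if x = Suc i then i else x)"
  by (simp add: sgen_def Transposition.transpose_def)

lemma sgen_sgen [simp]: "sgen i (sgen i x) = x"
  by (simp add: sgen_def)

lemma sgen_comp_sgen_comp [simp]: "sgen i \<circ> (sgen i \<circ> w) = w"
  by (simp add: fun_eq_iff)

lemma comp_sgen_comp_sgen [simp]: "w \<circ> sgen i \<circ> sgen i = w"
  by (simp add: fun_eq_iff)

lemma inj_on_sgen: "inj_on (sgen i) A"
  by (metis inj_onI sgen_sgen)

lemma inv_sgen [simp]: "inv (sgen i) = sgen i"
  by (simp add: sgen_def)

lemma sgen_in_perms [simp]: "i \<in> {1..<n} \<Longrightarrow> sgen i \<in> perms n"
  by (simp add: sgen_def perms_def permutes_swap_id)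

lemma sgen_comp_in_perms_iff [simp]:
  "i \<in> {1..<n} \<Longrightarrow> sgen i \<circ> w \<in> perms n \<longleftrightarrow> w \<in> perms n"
  using inv_comp_in_perms_iff[of "sgen i" n w] by simp

lemma comp_sgen_in_perms_iff [simp]:
  "i \<in> {1..<n} \<Longrightarrow> w \<circ> sgen i \<in> perms n \<longleftrightarrow> w \<in> perms n"
  by (metis comp_in_perms sgen_in_perms comp_sgen_comp_sgen)

lemma inv_sgen_comp: "w \<in> perms n \<Longrightarrow> i \<in> {1..<n} \<Longrightarrow> inv (sgen i \<circ> w) = inv w \<circ> sgen i"
  by (simp add: inv_comp_perms[where n = n])

lemma inv_comp_sgen: "w \<in> perms n \<Longrightarrow> i \<in> {1..<n} \<Longrightarrow> inv (w \<circ> sgen i) = sgen i \<circ> inv w"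
  by (simp add: inv_comp_perms[where n = n])

lemma sgen_comp_eq_comp_sgen:
  assumes "bij v" "{v j, v (Suc j)} = {i, Suc i}"
  shows "sgen i \<circ> v = v \<circ> sgen j"
proof -
  have "sgen i = Transposition.transpose (v j) (v (Suc j))"
    using assms(2) by (auto simp: sgen_def doubleton_eq_iff transpose_commute)
  then show ?thesis
    using transpose_comp_eq[OF assms(1)] assms(1) by (simp add: sgen_def bij_is_inj)
qed

lemma sgen_less_iff:
  assumes "x \<noteq> y" "{x, y} \<noteq> {j, Suc j}"
  shows "sgen j x < sgen j y \<longleftrightarrow> x < y"
  using assms by (auto simp: sgen_apply)

definition descent :: "(nat \<Rightarrow> nat) \<Rightarrow> nat \<Rightarrow> bool" where
  "descent w i \<longleftrightarrow> w (Suc i) < w i"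

lemma not_descent_iff: "w \<in> perms n \<Longrightarrow> \<not> descent w i \<longleftrightarrow> w i < w (Suc i)"
  using perms_inj[of w n] by (auto simp: descent_def inj_eq not_less le_less)

lemma descent_comp_sgen_iff: "w \<in> perms n \<Longrightarrow> descent (w \<circ> sgen i) i \<longleftrightarrow> \<not> descent w i"
  by (simp add: not_descent_iff) (simp add: descent_def sgen_apply)

lemma descent_inv_sgen_comp_iff:
  assumes "w \<in> perms n" "i \<in> {1..<n}"
  shows "descent (inv (sgen i \<circ> w)) i \<longleftrightarrow> \<not> descent (inv w) i"
  unfolding inv_sgen_comp[OF assms] by (rule descent_comp_sgen_iff[OF inv_in_perms[OF assms(1)]])

definition inversions :: "nat \<Rightarrow> (nat \<Rightarrow> nat) \<Rightarrow> (nat \<times> nat) set" where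
  "inversions n w = {(a, b). a \<in> {1..n} \<and> b \<in> {1..n} \<and> a < b \<and> w b < w a}"

lemma len_eq_card_inversions: "len n w = card (inversions n w)"
  by (simp add: len_def inversions_def)

lemma finite_inversions: "finite (inversions n w)"
  by (rule finite_subset[of _ "{1..n} \<times> {1..n}"]) (auto simp: inversions_def)

lemma len_id [simp]: "len n id = 0"
proof -
  have "inversions n id = {}" by (auto simp: inversions_def)
  then show ?thesis by (simp add: len_eq_card_inversions)
qed

lemma inversions_sgen_comp:
  assumes w: "w \<in> perms n" and i: "i \<in> {1..<n}" and ascent: "\<not> descent (inv w) i"
  shows "inversions n (sgen i \<circ> w) = insert (inv w i, inv w (Suc i)) (inversions n w)"
proof (rule set_eqI, clarify)
  fix a b
  have inv_less: "inv w i < inv w (Suc i)"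
    using ascent w by (simp add: not_descent_iff[of _ n])
  have swapped: "sgen i (w b) < sgen i (w a) \<longleftrightarrow> w b < w a \<or> (w a = i \<and> w b = Suc i)"
    if "a < b"
  proof -
    have "w a \<noteq> w b" using that perms_inj[OF w] by (simp add: inj_eq)
    moreover have "\<not> (w a = Suc i \<and> w b = i)"
      using inv_less that perms_inv_apply[OF w] by (metis less_asym)
    ultimately show ?thesis by (auto simp: sgen_apply)
  qed
  have "(w a = i \<and> w b = Suc i) \<longleftrightarrow> (a, b) = (inv w i, inv w (Suc i))"
    using perms_apply_inv[OF w] perms_inv_apply[OF w] by (metis prod.inject)
  moreover have "inv w i \<in> {1..n}" "inv w (Suc i) \<in> {1..n}"
    using i perms_in_range_iff[OF inv_in_perms[OF w]] by auto
  ultimately show "(a, b) \<in> inversions n (sgen i \<circ> w)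
      \<longleftrightarrow> (a, b) \<in> insert (inv w i, inv w (Suc i)) (inversions n w)"
    using swapped inv_less by (cases "a < b") (auto simp: inversions_def)
qed

lemma len_sgen_comp_ascent:
  assumes "w \<in> perms n" "i \<in> {1..<n}" "\<not> descent (inv w) i"
  shows "len n (sgen i \<circ> w) = Suc (len n w)"
proof -
  have "(inv w i, inv w (Suc i)) \<notin> inversions n w"
    by (simp add: inversions_def perms_apply_inv[OF assms(1)])
  then show ?thesis
    by (simp add: len_eq_card_inversions inversions_sgen_comp[OF assms] finite_inversions)
qed

lemma len_sgen_comp_descent:
  assumes "w \<in> perms n" "i \<in> {1..<n}" "descent (inv w) i"
  shows "Suc (len n (sgen i \<circ> w)) = len n w"
  using len_sgen_comp_ascent[of "sgen i \<circ> w" n i] assms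
  by (simp add: descent_inv_sgen_comp_iff)

lemma len_sgen_comp_less_iff:
  assumes "w \<in> perms n" "i \<in> {1..<n}"
  shows "len n (sgen i \<circ> w) < len n w \<longleftrightarrow> descent (inv w) i"
  using len_sgen_comp_ascent[OF assms] len_sgen_comp_descent[OF assms]
  by (cases "descent (inv w) i") auto

lemma len_sgen_comp_le:
  assumes "w \<in> perms n" "i \<in> {1..<n}"
  shows "len n (sgen i \<circ> w) \<le> Suc (len n w)"
  using len_sgen_comp_ascent[OF assms] len_sgen_comp_descent[OF assms]
  by (cases "descent (inv w) i") auto

lemma len_inv:
  assumes w: "w \<in> perms n" shows "len n (inv w) = len n w"
proof -
  note inverses = perms_apply_inv[OF w] perms_inv_apply[OF w]
    and range = perms_in_range_iff[OF w] perms_in_range_iff[OF inv_in_perms[OF w]]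
  have "bij_betw (\<lambda>(a, b). (w b, w a)) (inversions n w) (inversions n (inv w))"
    by (rule bij_betwI[where g = "\<lambda>(a, b). (inv w b, inv w a)"])
       (use inverses range in \<open>auto simp: inversions_def simp del: atLeastAtMost_iff\<close>)
  then show ?thesis by (simp add: len_eq_card_inversions bij_betw_same_card)
qed

lemma len_comp_sgen_ascent:
  assumes "w \<in> perms n" "i \<in> {1..<n}" "\<not> descent w i"
  shows "len n (w \<circ> sgen i) = Suc (len n w)"
proof -
  have "len n (w \<circ> sgen i) = len n (sgen i \<circ> inv w)"
    using len_inv[of "w \<circ> sgen i" n] assms by (simp add: inv_comp_sgen)
  also have "\<dots> = Suc (len n w)"
    using len_sgen_comp_ascent[of "inv w" n i] assms by (simp add: inv_inv_perms len_inv)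
  finally show ?thesis .
qed

lemma strict_mono_on_atLeastAtMost_if_less_Suc:
  fixes f :: "nat \<Rightarrow> 'b::order"
  assumes step: "\<And>i. i \<in> {a..<b} \<Longrightarrow> f i < f (Suc i)"
  shows "strict_mono_on {a..b} f"
proof (rule strict_mono_onI)
  fix r s assume "r \<in> {a..b}" "s \<in> {a..b}" "r < s"
  then show "f r < f s"
  proof (induction s)
    case (Suc s)
    then have "f s < f (Suc s)" by (intro step) simp
    then show ?case using Suc by (cases "r = s") (auto intro: less_trans)
  qed simp
qed

lemma strict_mono_on_eq_if_image_eq:
  fixes f g :: "'a::linorder \<Rightarrow> 'b::linorder"
  assumes "finite A" "strict_mono_on A f" "strict_mono_on A g" "f ` A = g ` A" "x \<in> A"
  shows "f x = g x"
proof -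
  let ?xs = "sorted_list_of_set A"
  have sorted_image: "sorted_list_of_set (h ` A) = map h ?xs" if h: "strict_mono_on A h"
    for h :: "'a \<Rightarrow> 'b"
  proof -
    have "sorted_wrt (\<lambda>x y. h x < h y) ?xs"
      using strict_sorted_list_of_set
      by (rule sorted_wrt_mono_rel[rotated]) (use assms(1) h in \<open>auto intro: strict_mono_onD\<close>)
    then show ?thesis
      using assms(1) strict_mono_on_imp_inj_on[OF h]
      by (subst sorted_list_of_set_unique[symmetric]) (simp_all add: sorted_wrt_map card_image)
  qed
  have "map f ?xs = map g ?xs"
    using sorted_image[OF assms(2)] sorted_image[OF assms(3)] assms(4) by simp
  then show ?thesis using assms(1,5) by simp
qed

lemma perms_without_descents:
  assumes w: "w \<in> perms n" and "\<And>i. i \<in> {1..<n} \<Longrightarrow> \<not> descent w i"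
  shows "w = id"
proof (rule ext)
  fix x
  have "strict_mono_on {1..n} w"
    using assms by (intro strict_mono_on_atLeastAtMost_if_less_Suc) (simp add: not_descent_iff)
  then have "w x = id x" if "x \<in> {1..n}"
    using strict_mono_on_eq_if_image_eq[OF _ _ strict_mono_on_id _ that] perms_image[OF w] by simp
  then show "w x = id x" using perms_fixes_outside[OF w] by auto
qed

lemma perms_induct [consumes 1, case_names id comp_sgen]:
  assumes "w \<in> perms n" and "P id"
    and step: "\<And>w i. w \<in> perms n \<Longrightarrow> i \<in> {1..<n} \<Longrightarrow> \<not> descent w i \<Longrightarrow> P w \<Longrightarrow> P (w \<circ> sgen i)"
  shows "P w"
  using assms(1)
proof (induction "len n w" arbitrary: w rule: less_induct)
  case less
  show ?case
  proof (cases "w = id")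
    case False
    then obtain i where i: "i \<in> {1..<n}" "descent w i"
      using perms_without_descents less.prems by blast
    let ?v = "w \<circ> sgen i"
    have v: "?v \<in> perms n" "\<not> descent ?v i"
      using less.prems i by (simp_all add: descent_comp_sgen_iff)
    have "len n ?v < len n w" using len_comp_sgen_ascent[OF v(1) i(1) v(2)] by simp
    then have "P ?v" using less.hyps v(1) by blast
    then have "P (?v \<circ> sgen i)" by (rule step[OF v(1) i(1) v(2)])
    then show ?thesis by simp
  qed (use assms(2) in simp)
qed

definition word_perm :: "nat list \<Rightarrow> nat \<Rightarrow> nat" where
  "word_perm is = foldr (\<lambda>i acc. sgen i \<circ> acc) is id"

lemma word_perm_simps [simp]:
  "word_perm [] = id" "word_perm (i # is) = sgen i \<circ> word_perm is"
  by (simp_all only: word_perm_def foldr.simps id_apply o_apply)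

lemma word_perm_append: "word_perm (is @ js) = word_perm is \<circ> word_perm js"
  by (induction "is") (simp_all add: comp_assoc)

lemma word_perm_in_perms: "set is \<subseteq> {1..<n} \<Longrightarrow> word_perm is \<in> perms n"
  by (induction "is") auto

lemma reduced_word_iff:
  "reduced_word n w is \<longleftrightarrow> set is \<subseteq> {1..<n} \<and> w = word_perm is \<and> length is = len n w"
  by (simp only: reduced_word_def word_perm_def)

lemma len_word_perm_le: "set is \<subseteq> {1..<n} \<Longrightarrow> len n (word_perm is) \<le> length is"
proof (induction "is")
  case (Cons i "is")
  then have "len n (sgen i \<circ> word_perm is) \<le> Suc (len n (word_perm is))"
    by (intro len_sgen_comp_le word_perm_in_perms) auto
  also have "\<dots> \<le> length (i # is)" using Cons by simp
  finally show ?case unfolding word_perm_simps .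
qed (simp only: word_perm_simps len_id)

lemma reduced_word_exists:
  assumes "w \<in> perms n"
  obtains "is" where "reduced_word n w is"
proof -
  have "\<exists>is. reduced_word n w is"
    using assms
  proof (induction rule: perms_induct)
    case id
    have "reduced_word n id []" by (simp add: reduced_word_iff)
    then show ?case ..
  next
    case (comp_sgen w i)
    then obtain "is" where "reduced_word n w is" by blast
    moreover have "len n (w \<circ> sgen i) = Suc (len n w)"
      using comp_sgen.hyps by (rule len_comp_sgen_ascent)
    ultimately have "reduced_word n (w \<circ> sgen i) (is @ [i])"
      using comp_sgen.hyps(2) by (simp add: reduced_word_iff word_perm_append)
    then show ?case ..
  qed
  then show ?thesis using that by blast
qed

lemma reduced_word_ConsD:
  assumes "reduced_word n w (i # is)"
  shows "i \<in> {1..<n}" "reduced_word n (word_perm is) is" "\<not> descent (inv (word_perm is)) i"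
proof -
  show i: "i \<in> {1..<n}" using assms by (simp add: reduced_word_iff)
  have letters: "set is \<subseteq> {1..<n}"
    and length: "len n (sgen i \<circ> word_perm is) = Suc (length is)"
    using assms by (auto simp: reduced_word_iff)
  note w = word_perm_in_perms[OF letters]
  show ascent: "\<not> descent (inv (word_perm is)) i"
    using len_sgen_comp_descent[OF w i] len_word_perm_le[OF letters] length by auto
  show "reduced_word n (word_perm is) is"
    using len_sgen_comp_ascent[OF w i ascent] letters length by (simp add: reduced_word_iff)
qed

section \<open>Entries and the Gale order\<close>

lemma strict_mono_on_entry: "strict_mono_on {1..card A} (entry A)"
proof (rule strict_mono_onI)
  fix r s assume "r \<in> {1..card A}" "s \<in> {1..card A}" "r < s"
  then have "r - 1 < s - 1" "s - 1 < length (sorted_list_of_set A)" by auto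
  then show "entry A r < entry A s"
    using strict_sorted_list_of_set[of A] by (simp add: entry_def sorted_wrt_iff_nth_less)
qed

lemma entry_image:
  assumes "finite A" shows "entry A ` {1..card A} = A"
proof -
  have "entry A ` {1..card A} = (!) (sorted_list_of_set A) ` {..<card A}"
    unfolding image_Suc_lessThan[symmetric] image_image by (simp add: entry_def)
  also have "\<dots> = A"
    using bij_betw_nth[of "sorted_list_of_set A"] assms by (simp add: bij_betw_def)
  finally show ?thesis .
qed

lemma entry_atLeastAtMost: "k \<in> {1..m} \<Longrightarrow> entry {1..m} k = k"
  using strict_mono_on_eq_if_image_eq[of "{1..m}" "entry {1..m}" id k]
    strict_mono_on_entry[of "{1..m}"] entry_image[of "{1..m}"]
  by (simp add: strict_mono_on_id)

lemma entry_le_iff: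
  assumes A: "finite A" and k: "k \<in> {1..card A}"
  shows "entry A k \<le> x \<longleftrightarrow> k \<le> card (A \<inter> {..x})"
proof -
  let ?K = "{i \<in> {1..card A}. entry A i \<le> x}"
  note mono = strict_mono_on_entry[of A]
  have "A \<inter> {..x} = entry A ` {1..card A} \<inter> {..x}" by (simp only: entry_image[OF A])
  also have "\<dots> = entry A ` ?K" by auto
  finally have "A \<inter> {..x} = entry A ` ?K" .
  moreover have "inj_on (entry A) ?K"
    using strict_mono_on_imp_inj_on[OF mono] by (rule inj_on_subset) auto
  ultimately have card: "card (A \<inter> {..x}) = card ?K" by (simp add: card_image)
  show ?thesis
  proof (cases "entry A k \<le> x")
    case True
    have "{1..k} \<subseteq> ?K"
      using strict_mono_on_leD[OF mono _ k] True k by fastforce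
    then have "card {1..k} \<le> card ?K" by (intro card_mono) simp_all
    then show ?thesis using True card by simp
  next
    case False
    have "?K \<subseteq> {1..<k}"
      using strict_mono_on_leD[OF mono k] False by (force simp: not_le[symmetric])
    then have "card ?K \<le> card {1..<k}" by (intro card_mono) simp_all
    also have "\<dots> < k" using k by simp
    finally show ?thesis using False card by simp
  qed
qed

lemma mem_if_entry_le:
  assumes A: "finite A" "0 \<notin> A" and k: "k \<in> {1..card A}" "entry A k \<le> k"
  shows "k \<in> A"
proof -
  have "1 \<le> x" if "x \<in> A" for x using that A(2) by (cases x) auto
  then have "A \<inter> {..k} \<subseteq> {1..k}" by auto
  moreover have "k \<le> card (A \<inter> {..k})" using entry_le_iff[OF A(1) k(1)] k(2) by blast
  ultimately have "A \<inter> {..k} = {1..k}" by (intro card_seteq) simp_all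
  then have "k \<in> A \<inter> {..k}" using k(1) by simp
  then show ?thesis ..
qed

definition gale_le :: "nat set \<Rightarrow> nat set \<Rightarrow> bool" where
  "gale_le A B \<longleftrightarrow> (\<forall>x. card (B \<inter> {..x}) \<le> card (A \<inter> {..x}))"

lemma gale_le_refl: "gale_le A A"
  by (simp add: gale_le_def)

lemma gale_le_trans: "gale_le A B \<Longrightarrow> gale_le B C \<Longrightarrow> gale_le A C"
  unfolding gale_le_def by (blast intro: order_trans)

lemma gale_le_superset: "B \<subseteq> A \<Longrightarrow> gale_le A B"
  by (auto simp: gale_le_def intro!: card_mono)

lemma gale_le_imp_entry_le:
  assumes "finite A" "finite B" "gale_le A B" "k \<in> {1..card A}" "k \<in> {1..card B}"
  shows "entry A k \<le> entry B k"
proof -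
  have "k \<le> card (B \<inter> {..entry B k})" using entry_le_iff[OF assms(2,5)] by blast
  also have "\<dots> \<le> card (A \<inter> {..entry B k})" using assms(3) by (simp add: gale_le_def)
  finally show ?thesis using entry_le_iff[OF assms(1,4)] by blast
qed

section \<open>Columns\<close>

lemma scol_eq_sgen_image: "scol j C = sgen j ` C"
  by (simp add: scol_def sgen_def)

lemma scol_scol [simp]: "scol j (scol j C) = C"
  by (simp add: scol_eq_sgen_image image_image)

lemma card_scol [simp]: "card (scol j C) = card C"
  unfolding scol_eq_sgen_image by (rule card_image) (rule inj_on_sgen)

lemma mem_scol_iff: "x \<in> scol j C \<longleftrightarrow> sgen j x \<in> C"
  by (metis imageE image_eqI scol_eq_sgen_image sgen_sgen)

lemma mem_scol [simp]: "j \<in> scol j C \<longleftrightarrow> Suc j \<in> C" "Suc j \<in> scol j C \<longleftrightarrow> j \<in> C"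
  by (simp_all add: mem_scol_iff sgen_apply)

lemma scol_eq_self: "(j \<in> C \<longleftrightarrow> Suc j \<in> C) \<Longrightarrow> scol j C = C"
  unfolding scol_def by (rule transpose_image_eq)

lemma scol_subset: "C \<subseteq> {1..n} \<Longrightarrow> j \<in> {1..<n} \<Longrightarrow> scol j C \<subseteq> {1..n}"
  by (auto simp: scol_eq_sgen_image sgen_apply)

lemma card_scol_Int_atMost:
  assumes "x \<noteq> j" shows "card (scol j C \<inter> {..x}) = card (C \<inter> {..x})"
proof -
  have "sgen j y \<le> x \<longleftrightarrow> y \<le> x" for y using assms by (auto simp: sgen_apply)
  then have "scol j C \<inter> {..x} = scol j (C \<inter> {..x})"
    by (intro set_eqI) (simp add: mem_scol_iff)
  then show ?thesis by simp
qed

lemma card_Int_atMost_Suc: "card (C \<inter> {..Suc j}) = card (C \<inter> {..j}) + of_bool (Suc j \<in> C)"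
  by (simp add: atMost_Suc Int_insert_right)

lemma card_scol_Int_atMost_self:
  "card (scol j C \<inter> {..j}) + of_bool (j \<in> C) = card (C \<inter> {..j}) + of_bool (Suc j \<in> C)"
  using card_scol_Int_atMost[of "Suc j" j C] by (simp add: card_Int_atMost_Suc)

lemma gale_le_scol:
  assumes "j \<in> C" "Suc j \<notin> C" shows "gale_le C (scol j C)"
  unfolding gale_le_def
proof
  fix x
  show "card (scol j C \<inter> {..x}) \<le> card (C \<inter> {..x})"
    using card_scol_Int_atMost[of x j C] card_scol_Int_atMost_self[of j C] assms
    by (cases "x = j") auto
qed

text \<open>The only threshold at which reflecting both sides can hurt is \<open>j\<close>, and there \<open>scol j C\<close> has
  no element \<open>j\<close>, so the comparison at \<open>j - 1\<close> suffices.\<close>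

lemma gale_le_scol_lift:
  assumes "finite A" "1 \<le> j" "Suc j \<notin> C" "gale_le (scol j A) C"
  shows "gale_le A (scol j C)"
  unfolding gale_le_def
proof
  fix x
  show "card (scol j C \<inter> {..x}) \<le> card (A \<inter> {..x})"
  proof (cases "x = j")
    case True
    obtain i where i: "j = Suc i" using assms(2) by (cases j) simp_all
    have "card (scol j C \<inter> {..j}) = card (C \<inter> {..i})"
      using card_scol_Int_atMost_self[of j C] assms(3) i by (simp add: card_Int_atMost_Suc)
    also have "\<dots> \<le> card (A \<inter> {..i})"
      using assms(4) card_scol_Int_atMost[of i j A] i by (metis gale_le_def n_not_Suc_n)
    also have "\<dots> \<le> card (A \<inter> {..j})" using assms(1) i by (intro card_mono) auto
    finally show ?thesis using True by simp
  next
    case False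
    have "card (C \<inter> {..x}) \<le> card (scol j A \<inter> {..x})" using assms(4) by (simp add: gale_le_def)
    then show ?thesis by (simp only: card_scol_Int_atMost[OF False])
  qed
qed

lemma column_subset: "C \<in> cols n l \<Longrightarrow> C \<subseteq> {1..n}"
  by (simp add: cols_def)

lemma column_card: "C \<in> cols n l \<Longrightarrow> card C = l"
  by (simp add: cols_def)

lemma column_finite: "C \<in> cols n l \<Longrightarrow> finite C"
  by (rule finite_subset[OF column_subset]) simp_all

lemma column_length_le: "C \<in> cols n l \<Longrightarrow> l \<le> n"
  using card_mono[OF finite_atLeastAtMost column_subset, of C n l] by (simp add: column_card)

lemma finite_cols [simp]: "finite (cols n l)"
  by (rule finite_subset[of _ "Pow {1..n}"]) (auto simp: cols_def)

lemma subset_in_cols: "C \<subseteq> {1..n} \<Longrightarrow> C \<in> cols n (card C)"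
  by (simp add: cols_def)

lemma atLeastAtMost_in_cols: "l \<le> n \<Longrightarrow> {1..l} \<in> cols n l"
  by (auto simp: cols_def)

lemma scol_in_cols: "C \<in> cols n l \<Longrightarrow> j \<in> {1..<n} \<Longrightarrow> scol j C \<in> cols n l"
  using scol_subset by (auto simp: cols_def)

lemma perms_image_in_cols:
  assumes "w \<in> perms n" "l \<le> n" shows "w ` {1..l} \<in> cols n l"
proof -
  have "w ` {1..l} \<subseteq> w ` {1..n}" using assms(2) by (intro image_mono) simp
  moreover have "card (w ` {1..l}) = card {1..l}"
    by (intro card_image inj_on_subset[OF perms_inj[OF assms(1)] subset_UNIV])
  ultimately show ?thesis unfolding perms_image[OF assms(1)] by (simp add: cols_def)
qed

lemma downward_closed_eq_atLeastAtMost: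
  assumes C: "finite C" "0 \<notin> C" and closed: "\<And>j. 1 \<le> j \<Longrightarrow> Suc j \<in> C \<Longrightarrow> j \<in> C"
  shows "C = {1..card C}"
proof -
  have pos: "1 \<le> x" if "x \<in> C" for x using that C(2) by (cases x) auto
  have down: "k \<in> C" if "m \<in> C" "k \<le> m" "1 \<le> k" for m k
    using that(2)
  proof (induction rule: inc_induct)
    case (step i)
    then show ?case using closed[of i] that(3) by simp
  qed (use that in simp)
  have "C = {1..Max (insert 0 C)}"
  proof (intro equalityI subsetI)
    fix x assume "x \<in> C"
    then show "x \<in> {1..Max (insert 0 C)}" using C(1) pos by auto
  next
    fix x assume x: "x \<in> {1..Max (insert 0 C)}"
    then have "Max (insert 0 C) \<in> C" using Max_in[of "insert 0 C"] C(1) by auto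
    then show "x \<in> C" using x down by auto
  qed
  then show ?thesis by (metis card_atLeastAtMost diff_Suc_1 One_nat_def)
qed

lemma cols_induct [consumes 1, case_names highest scol]:
  assumes "C \<in> cols n l" and "P {1..l}"
    and step: "\<And>C j. C \<in> cols n l \<Longrightarrow> j \<in> {1..<n} \<Longrightarrow> j \<in> C \<Longrightarrow> Suc j \<notin> C \<Longrightarrow> P C
      \<Longrightarrow> P (scol j C)"
  shows "P C"
  using assms(1)
proof (induction "\<Sum>C" arbitrary: C rule: less_induct)
  case less
  note C = less.prems
  show ?case
  proof (cases "C = {1..l}")
    case False
    have "0 \<notin> C" using column_subset[OF C] by auto
    then obtain j where j: "1 \<le> j" "Suc j \<in> C" "j \<notin> C"
      using downward_closed_eq_atLeastAtMost[OF column_finite[OF C]] column_card[OF C] False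
      by blast
    then have j_less: "j \<in> {1..<n}" using column_subset[OF C] by auto
    note scol = scol_in_cols[OF C j_less]
    have "\<Sum>(scol j C) = (\<Sum>x\<in>C. sgen j x)"
      unfolding scol_eq_sgen_image by (subst sum.reindex[OF inj_on_sgen]) simp
    also have "\<dots> < \<Sum>C"
      by (rule sum_strict_mono_ex1) (use j column_finite[OF C] in \<open>auto simp: sgen_apply\<close>)
    finally have "P (scol j C)" using less.hyps[OF _ scol] by simp
    then show ?thesis using step[OF scol j_less] j by simp
  qed (use assms(2) in simp)
qed

lemma uC_eq_entry: "k \<in> {1..card C} \<Longrightarrow> uC n C k = entry C k"
  by (simp add: uC_def)

lemma uC_eq_entry_compl: "k \<in> {Suc (card C)..n} \<Longrightarrow> uC n C k = entry ({1..n} - C) (k - card C)"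
  by (simp add: uC_def entry_def One_nat_def)

lemma uC_image:
  assumes "C \<in> cols n l" shows "uC n C ` {1..l} = C"
  using entry_image[OF column_finite[OF assms]] image_cong[OF refl uC_eq_entry, of "{1..l}"]
    column_card[OF assms] by simp

lemma strict_mono_on_uC:
  assumes "C \<in> cols n l" shows "strict_mono_on {1..l} (uC n C)"
  using strict_mono_on_entry[of C] uC_eq_entry[of _ C n] column_card[OF assms]
  by (simp add: strict_mono_on_def)

lemma card_compl_column:
  assumes "C \<in> cols n l" shows "card ({1..n} - C) = n - l"
  using column_finite[OF assms] column_subset[OF assms] column_card[OF assms]
  by (simp add: card_Diff_subset)

lemma strict_mono_on_uC_compl:
  assumes C: "C \<in> cols n l" shows "strict_mono_on {Suc l..n} (uC n C)"
proof (rule strict_mono_onI)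
  fix r s assume "r \<in> {Suc l..n}" "s \<in> {Suc l..n}" "r < s"
  then show "uC n C r < uC n C s"
    using strict_mono_onD[OF strict_mono_on_entry[of "{1..n} - C"], of "r - l" "s - l"]
    by (simp add: uC_eq_entry_compl card_compl_column[OF C] column_card[OF C])
qed

lemma uC_image_compl:
  assumes C: "C \<in> cols n l" shows "uC n C ` {Suc l..n} = {1..n} - C"
proof -
  let ?C' = "{1..n} - C"
  have "uC n C ` {Suc l..n} = (\<lambda>k. entry ?C' (k - l)) ` {Suc l..n}"
    using uC_eq_entry_compl[of _ C n] column_card[OF C] by (intro image_cong) simp_all
  also have "\<dots> = (\<lambda>k. entry ?C' (k - l)) ` (\<lambda>k. k + l) ` {1..n - l}"
    using column_length_le[OF C] by (simp add: One_nat_def)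
  also have "\<dots> = entry ?C' ` {1..card ?C'}"
    unfolding image_image card_compl_column[OF C] by simp
  also have "\<dots> = ?C'" by (simp only: entry_image finite_Diff finite_atLeastAtMost)
  finally show ?thesis .
qed

lemma uC_in_perms:
  assumes C: "C \<in> cols n l" shows "uC n C \<in> perms n"
proof -
  have "{1..n} = {1..l} \<union> {Suc l..n}" using column_length_le[OF C] by auto
  then have "uC n C ` {1..n} = C \<union> ({1..n} - C)"
    by (simp only: image_Un uC_image[OF C] uC_image_compl[OF C])
  then have image: "uC n C ` {1..n} = {1..n}" using column_subset[OF C] by auto
  then have "inj_on (uC n C) {1..n}" by (intro eq_card_imp_inj_on) simp_all
  with image have "bij_betw (uC n C) {1..n} {1..n}" by (simp add: bij_betw_def)
  then show ?thesis
    unfolding perms_def mem_Collect_eq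
    by (rule bij_imp_permutes) (use column_card[OF C] column_length_le[OF C] in \<open>auto simp: uC_def\<close>)
qed

lemma uC_unique:
  assumes C: "C \<in> cols n l" and w: "w \<in> perms n" "w ` {1..l} = C"
    and mono: "strict_mono_on {1..l} w" "strict_mono_on {Suc l..n} w"
  shows "w = uC n C"
proof (rule ext)
  fix k
  have "w ` ({1..n} - {1..l}) = {1..n} - C"
    using w by (simp add: image_set_diff perms_inj perms_image)
  moreover have "{1..n} - {1..l} = {Suc l..n}" by auto
  ultimately have image: "w ` {Suc l..n} = {1..n} - C" by simp
  consider (column) "k \<in> {1..l}" | (compl) "k \<in> {Suc l..n}" | (outside) "k \<notin> {1..n}" by force
  then show "w k = uC n C k"
  proof cases
    case column
    then show ?thesis
      using strict_mono_on_eq_if_image_eq[OF _ mono(1) strict_mono_on_uC[OF C]] w(2) uC_image[OF C]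
      by simp
  next
    case compl
    then show ?thesis
      using strict_mono_on_eq_if_image_eq[OF _ mono(2) strict_mono_on_uC_compl[OF C]]
        image uC_image_compl[OF C] by simp
  next
    case outside
    then show ?thesis
      using perms_fixes_outside[OF w(1)] perms_fixes_outside[OF uC_in_perms[OF C]] by simp
  qed
qed

lemma uC_atLeastAtMost: "l \<le> n \<Longrightarrow> uC n {1..l} = id"
  using uC_unique[OF atLeastAtMost_in_cols id_in_perms, of l n] by (simp add: strict_mono_on_id)

lemma uC_mem_iff:
  assumes "C \<in> cols n l" shows "uC n C k \<in> C \<longleftrightarrow> k \<in> {1..l}"
  using uC_image[OF assms] perms_inj[OF uC_in_perms[OF assms]]
  by (metis inj_image_mem_iff)

lemma uC_scol:
  assumes C: "C \<in> cols n l" and j: "j \<in> {1..<n}" "j \<in> C" "Suc j \<notin> C"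
  shows "uC n (scol j C) = sgen j \<circ> uC n C"
proof (rule uC_unique[symmetric])
  note mem = uC_mem_iff[OF C]
  have sgen_less: "sgen j x < sgen j y" if "x < y" "x \<noteq> j \<or> y \<noteq> Suc j" for x y
    using that by (auto simp: sgen_apply)
  show "scol j C \<in> cols n l" using C j(1) by (rule scol_in_cols)
  show "sgen j \<circ> uC n C \<in> perms n" using j(1) uC_in_perms[OF C] by simp
  show "(sgen j \<circ> uC n C) ` {1..l} = scol j C"
    by (simp only: image_comp[symmetric] uC_image[OF C] scol_eq_sgen_image)
  show "strict_mono_on {1..l} (sgen j \<circ> uC n C)"
  proof (rule strict_mono_onI)
    fix a b assume "a \<in> {1..l}" "b \<in> {1..l}" "a < b"
    then have "uC n C a < uC n C b" "uC n C b \<noteq> Suc j"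
      using strict_mono_onD[OF strict_mono_on_uC[OF C]] mem[of b] j(3) by auto
    then show "(sgen j \<circ> uC n C) a < (sgen j \<circ> uC n C) b" by (simp add: sgen_less)
  qed
  show "strict_mono_on {Suc l..n} (sgen j \<circ> uC n C)"
  proof (rule strict_mono_onI)
    fix a b assume "a \<in> {Suc l..n}" "b \<in> {Suc l..n}" "a < b"
    then have "uC n C a < uC n C b" "uC n C a \<noteq> j"
      using strict_mono_onD[OF strict_mono_on_uC_compl[OF C]] mem[of a] j(2) by auto
    then show "(sgen j \<circ> uC n C) a < (sgen j \<circ> uC n C) b" by (simp add: sgen_less)
  qed
qed

lemma strict_mono_on_eq_Suc:
  fixes f :: "nat \<Rightarrow> nat"
  assumes mono: "strict_mono_on {a..b} f"
    and mem: "i \<in> {a..b}" "k \<in> {a..b}" and consecutive: "f k = Suc (f i)"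
  shows "k = Suc i"
proof (rule ccontr)
  assume "k \<noteq> Suc i"
  moreover have "i < k" using strict_mono_on_less[OF mono mem] consecutive by simp
  ultimately have "Suc i < k" "Suc i \<in> {a..b}" using mem by auto
  then have "f i < f (Suc i)" "f (Suc i) < f k" using strict_mono_onD[OF mono] mem by auto
  then show False using consecutive by simp
qed

lemma uC_consecutive_preimages:
  assumes C: "C \<in> cols n l" and j: "j \<in> {1..<n}" "j \<in> C \<longleftrightarrow> Suc j \<in> C"
  obtains i where "i \<in> {1..<n}" "i \<noteq> l" "uC n C i = j" "uC n C (Suc i) = Suc j"
proof -
  note u = uC_in_perms[OF C] and mem = uC_mem_iff[OF C]
  define i k where "i = inv (uC n C) j" and "k = inv (uC n C) (Suc j)"
  have uC: "uC n C i = j" "uC n C k = Suc j" by (simp_all add: i_def k_def perms_apply_inv[OF u])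
  have range: "i \<in> {1..n}" "k \<in> {1..n}"
    using perms_in_range_iff[OF u, of i] perms_in_range_iff[OF u, of k] uC j(1) by auto
  have same_block: "i \<in> {1..l} \<longleftrightarrow> k \<in> {1..l}" using mem[of i] mem[of k] uC j(2) by simp
  have k_eq: "k = Suc i"
  proof (cases "i \<in> {1..l}")
    case True
    then show ?thesis
      using strict_mono_on_eq_Suc[OF strict_mono_on_uC[OF C], of i k] same_block uC by simp
  next
    case False
    then have "i \<in> {Suc l..n}" "k \<in> {Suc l..n}" using same_block range by auto
    then show ?thesis
      using strict_mono_on_eq_Suc[OF strict_mono_on_uC_compl[OF C], of i k] uC by simp
  qed
  show ?thesis
  proof (rule that)
    show "i \<in> {1..<n}" using range k_eq by simp
    show "i \<noteq> l" using same_block range(1) k_eq by auto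
    show "uC n C i = j" "uC n C (Suc i) = Suc j" using uC k_eq by simp_all
  qed
qed

lemma not_descent_inv_if_image:
  assumes w: "w \<in> perms n" and j: "j \<in> w ` {1..l}" "Suc j \<notin> w ` {1..l}" "Suc j \<le> n"
  shows "\<not> descent (inv w) j"
proof -
  have "inv w j \<in> {1..l}" using j(1) perms_inv_apply[OF w] by auto
  moreover have "inv w (Suc j) \<notin> {1..l}" using j(2) perms_apply_inv[OF w] by (metis image_eqI)
  moreover have "inv w (Suc j) \<in> {1..n}"
    using perms_in_range_iff[OF inv_in_perms[OF w]] j(3) by simp
  ultimately show ?thesis by (auto simp: descent_def)
qed

lemma not_descent_inv_uC:
  assumes "C \<in> cols n l" "j \<in> {1..<n}" "j \<in> C" "Suc j \<notin> C"
  shows "\<not> descent (inv (uC n C)) j"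
  using not_descent_inv_if_image[OF uC_in_perms[OF assms(1)], of j l] assms
  by (simp add: uC_image[OF assms(1)])

lemma stab_in_perms: "v \<in> stab n lam \<Longrightarrow> v \<in> perms n"
  by (simp add: stab_def)

lemma sgen_comp_in_stab_iff:
  assumes "i \<in> {1..<n}" "lam i = lam (Suc i)"
  shows "sgen i \<circ> v \<in> stab n lam \<longleftrightarrow> v \<in> stab n lam"
proof -
  have "lam (sgen i x) = lam x" for x using assms(2) by (simp add: sgen_apply)
  then show ?thesis using assms(1) by (simp add: stab_def)
qed

lemma stab_varpi_iff:
  assumes "l \<le> n"
  shows "v \<in> stab n (varpi l) \<longleftrightarrow> v \<in> perms n \<and> v ` {1..l} = {1..l}"
proof
  assume v: "v \<in> stab n (varpi l)"
  then have p: "v \<in> perms n" by (rule stab_in_perms)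
  have "v i \<in> {1..l}" if i: "i \<in> {1..l}" for i
  proof -
    have "varpi l (v i) = varpi l i" using v i assms by (auto simp: stab_def)
    then show ?thesis
      using perms_in_range_iff[OF p, of i] i assms by (auto simp: varpi_def split: if_splits)
  qed
  then have "v ` {1..l} \<subseteq> {1..l}" by blast
  then have "v ` {1..l} = {1..l}"
    using perms_inj[OF p] by (intro endo_inj_surj) (auto intro: inj_on_subset)
  then show "v \<in> perms n \<and> v ` {1..l} = {1..l}" using p by simp
next
  assume v: "v \<in> perms n \<and> v ` {1..l} = {1..l}"
  have "v i \<le> l \<longleftrightarrow> i \<le> l" if "i \<in> {1..n}" for i
  proof -
    have "v i \<in> {1..l} \<longleftrightarrow> i \<in> {1..l}" using v perms_inj[of v n] by (metis inj_image_mem_iff)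
    then show ?thesis using that perms_in_range_iff[of v n i] v by auto
  qed
  then show "v \<in> stab n (varpi l)" using v by (auto simp: stab_def varpi_def)
qed

lemma uC_comp_stab_in_perms:
  assumes "C \<in> cols n l" "v \<in> stab n lam" shows "uC n C \<circ> v \<in> perms n"
  using uC_in_perms[OF assms(1)] stab_in_perms[OF assms(2)] by (rule comp_in_perms)

lemma uC_comp_stab_image:
  assumes C: "C \<in> cols n l" and v: "v \<in> stab n (varpi l)"
  shows "(uC n C \<circ> v) ` {1..l} = C"
proof -
  have "v ` {1..l} = {1..l}" using v stab_varpi_iff[OF column_length_le[OF C]] by blast
  then show ?thesis by (simp only: image_comp[symmetric] uC_image[OF C])
qed

lemma inv_uC_comp_in_stab_iff:
  assumes C: "C \<in> cols n l" and w: "w \<in> perms n"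
  shows "inv (uC n C) \<circ> w \<in> stab n (varpi l) \<longleftrightarrow> w ` {1..l} = C"
proof -
  note u = uC_in_perms[OF C] and image = uC_image[OF C]
  have "(inv (uC n C) \<circ> w) ` {1..l} = {1..l} \<longleftrightarrow> w ` {1..l} = C"
  proof
    assume "(inv (uC n C) \<circ> w) ` {1..l} = {1..l}"
    then have "(uC n C \<circ> (inv (uC n C) \<circ> w)) ` {1..l} = uC n C ` {1..l}"
      by (simp only: image_comp[symmetric])
    then show "w ` {1..l} = C" by (simp add: image o_assoc perms_comp_inv[OF u])
  next
    assume "w ` {1..l} = C"
    then have "(inv (uC n C) \<circ> w) ` {1..l} = (inv (uC n C) \<circ> uC n C) ` {1..l}"
      by (simp only: image_comp[symmetric] image)
    then show "(inv (uC n C) \<circ> w) ` {1..l} = {1..l}" by (simp add: perms_inv_comp[OF u])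
  qed
  then show ?thesis
    using stab_varpi_iff[OF column_length_le[OF C]] inv_comp_in_perms_iff[OF u] w by simp
qed

section \<open>Tableaux\<close>

definition tableau :: "nat \<Rightarrow> nat set list \<Rightarrow> bool" where
  "tableau n T \<longleftrightarrow> set T \<subseteq> Pow {1..n} \<and> sorted_wrt (\<lambda>C D. card D \<le> card C) T"

lemma tableau_Cons:
  "tableau n (C # T) \<longleftrightarrow> C \<subseteq> {1..n} \<and> (\<forall>D\<in>set T. card D \<le> card C) \<and> tableau n T"
  by (auto simp: tableau_def)

lemma tableau_append:
  "tableau n (S @ T) \<longleftrightarrow> tableau n S \<and> tableau n T \<and> (\<forall>C\<in>set S. \<forall>D\<in>set T. card D \<le> card C)"
  by (auto simp: tableau_def sorted_wrt_append)

lemma stab_shape_Cons: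
  assumes "\<forall>D\<in>set T. card D \<le> card C"
  shows "stab n (shape (C # T)) = stab n (varpi (card C)) \<inter> stab n (shape T)"
proof -
  have shape_Cons: "shape (C # T) i = varpi (card C) i + shape T i" for i
    by (simp add: shape_def varpi_def)
  have outside: "shape T i = 0" if "card C < i" for i
    using assms that by (force simp: shape_def filter_empty_conv)
  have nonneg: "0 \<le> shape T i" for i by (simp add: shape_def)
  have "shape (C # T) a = shape (C # T) b
      \<longleftrightarrow> varpi (card C) a = varpi (card C) b \<and> shape T a = shape T b" for a b
    using outside[of a] outside[of b] nonneg[of a] nonneg[of b]
    by (auto simp: shape_Cons varpi_def)
  then show ?thesis by (auto simp: stab_def)
qed

lemma shape_eq_if_semistandard:
  assumes tab: "tableau n (T @ X)" and T: "T \<noteq> []" and X: "highest_weight X"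
    and semistd: "semistandard (T @ X)" and j: "1 \<le> j" "j \<notin> last T"
  shows "shape X j = shape X (Suc j)"
proof (cases X)
  case Nil
  then show ?thesis by (simp add: shape_def)
next
  case (Cons D Y)
  let ?C = "last T"
  have C: "?C \<subseteq> {1..n}" and card_le: "card D \<le> card ?C"
    and card_D: "\<forall>E\<in>set X. card E \<le> card D"
    using tab last_in_set[OF T] Cons
    by (auto simp add: tableau_def sorted_wrt_append simp del: atLeastAtMost_iff)
  have D: "D = {1..card D}" using X Cons by (simp add: highest_weight_def)
  have "(T @ X) ! (length T - 1) = ?C" "(T @ X) ! Suc (length T - 1) = D"
    "Suc (length T - 1) < length (T @ X)"
    using T Cons by (simp_all add: nth_append last_conv_nth)
  then have "\<forall>k\<in>{1..card D}. entry ?C k \<le> entry D k"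
    using semistd unfolding semistandard_def by metis
  then have entry_le: "entry ?C k \<le> k" if "k \<in> {1..card D}" for k
    using that entry_atLeastAtMost[OF that] D by metis
  have "card D < j"
  proof (rule ccontr)
    assume "\<not> card D < j"
    then have "j \<in> {1..card D}" using j(1) by simp
    then have "j \<in> {1..card ?C}" "entry ?C j \<le> j" using card_le entry_le by simp_all
    moreover have "finite ?C" "0 \<notin> ?C" using C by (auto intro: finite_subset)
    ultimately show False using mem_if_entry_le j(2) by blast
  qed
  then have "shape X i = 0" if "j \<le> i" for i
    using that card_D by (fastforce simp: shape_def filter_empty_conv)
  then show ?thesis by simp
qed

lemma highest_weight_T0: "highest_weight (T0 n mu)"
  by (simp add: highest_weight_def T0_def del: upt_Suc)

lemma card_T0_le_nparts:
  assumes "C \<in> set (T0 n mu)" shows "card C \<le> nparts n mu"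
proof -
  obtain c where c: "1 \<le> c" "card C = card {i \<in> {1..n}. c \<le> mu i}"
    using assms by (auto simp: T0_def simp del: upt_Suc)
  then show ?thesis by (auto simp: nparts_def intro!: card_mono)
qed

lemma tableau_T0: "tableau n (T0 n mu)"
proof -
  let ?m = "\<lambda>c. card {i \<in> {1..n}. c \<le> mu i}"
  have "?m c \<le> n" for c using card_mono[of "{1..n}" "{i \<in> {1..n}. c \<le> mu i}"] by fastforce
  then have "{1..?m c} \<in> Pow {1..n}" for c by simp
  then have "set (T0 n mu) \<subseteq> Pow {1..n}" unfolding T0_def set_map by blast
  moreover have "?m d \<le> ?m c" if "c \<le> d" for c d using that by (intro card_mono) auto
  then have "sorted_wrt (\<lambda>C D. card D \<le> card C) (T0 n mu)"
    by (simp add: T0_def sorted_wrt_iff_nth_less del: upt_Suc)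
  ultimately show ?thesis by (simp add: tableau_def)
qed

lemma tableau_append_T0:
  assumes T: "is_tab n T" and "nparts n mu \<le> card (last T)"
  shows "tableau n (T @ T0 n mu)"
proof -
  have tab: "tableau n T" and "T \<noteq> []" using T by (auto simp: is_tab_def tableau_def)
  then have "\<forall>C\<in>set T. card (last T) \<le> card C"
    by (cases T rule: rev_cases) (auto simp: tableau_def sorted_wrt_append)
  then show ?thesis
    using tab tableau_T0 card_T0_le_nparts assms(2) by (force simp: tableau_append)
qed

definition sign_changes :: "nat \<Rightarrow> nat set list \<Rightarrow> nat set" where
  "sign_changes j T =
    {k \<in> {1..<length T}. sigma j (colk T k) * sigma j (colk T (Suc k)) = -1}"

lemma colk_Cons: "1 \<le> k \<Longrightarrow> k \<le> length T \<Longrightarrow> colk (C # T) k = colk T k"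
  by (simp add: colk_def Suc_diff_le)

lemma colk_length: "T \<noteq> [] \<Longrightarrow> colk T (length T) = hd T"
  by (simp add: colk_def hd_conv_nth)

lemma Omega_Cons: "k \<le> length T \<Longrightarrow> Omega j k (C # T) = C # Omega j k T"
  by (simp add: Omega_def Suc_diff_le)

lemma Omega_length: "Omega j (length T) T = map (scol j) T"
  by (simp add: Omega_def)

lemma Omega_neq_Nil [simp]: "Omega j k T \<noteq> [] \<longleftrightarrow> T \<noteq> []"
  by (cases "length T - k") (auto simp: Omega_def)

lemma Omega_columns:
  assumes "set T \<subseteq> Pow {1..n}" "j \<in> {1..<n}"
  shows "set (Omega j k T) \<subseteq> Pow {1..n}"
proof -
  have "scol j C \<in> Pow {1..n}" if "C \<in> set T" for C
    using that assms(1) scol_subset[OF _ assms(2)] by blast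
  then show ?thesis
    unfolding Omega_def set_append set_map
    using assms(1) by (blast dest: in_set_takeD in_set_dropD)
qed

lemma finite_sign_changes: "finite (sign_changes j T)"
  by (simp add: sign_changes_def)

lemma sign_changesD: "k \<in> sign_changes j T \<Longrightarrow> 1 \<le> k \<and> k < length T"
  by (simp add: sign_changes_def)

lemma sign_changes_Cons:
  assumes "T \<noteq> []"
  shows "sign_changes j (C # T) =
    (if sigma j (hd T) * sigma j C = -1 then insert (length T) (sign_changes j T)
     else sign_changes j T)"
proof -
  have "{1..<length (C # T)} = insert (length T) {1..<length T}"
    using assms by (auto simp: Suc_le_eq One_nat_def)
  moreover have "colk (C # T) (Suc (length T)) = C" by (simp add: colk_def)
  ultimately show ?thesis
    using colk_length[OF assms] assms
    by (auto simp: sign_changes_def colk_Cons Suc_le_eq One_nat_def)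
qed

section \<open>The finite Hecke algebra\<close>

lemma hadd_eq_plus: "hadd g h = g + h"
  by (simp add: hadd_def plus_fun_def)

lemma hzero_eq_0: "hzero = 0"
  by (simp add: hzero_def zero_fun_def)

lemma sum_fun_apply: "(\<Sum>x\<in>A. f x) y = (\<Sum>x\<in>A. f x y)"
  for f :: "'b \<Rightarrow> 'c \<Rightarrow> 'd::comm_monoid_add"
  by (induction A rule: infinite_finite_induct) simp_all

lemma hsum_eq_sum: "hsum f A = sum f A"
  by (simp add: hsum_def sum_fun_apply fun_eq_iff)

lemma hscale_apply [simp]: "hscale c h w = c * h w"
  by (simp add: hscale_def)

interpretation hecke_module: module "hscale :: 'a::comm_ring_1 \<Rightarrow> 'a hecke \<Rightarrow> 'a hecke"
  by unfold_locales (simp_all add: fun_eq_iff algebra_simps)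

abbreviation hlinear :: "('a::comm_ring_1 hecke \<Rightarrow> 'a hecke) \<Rightarrow> bool" where
  "hlinear \<equiv> module_hom hscale hscale"

lemma hlinearI:
  assumes "\<And>g h. f (g + h) = f g + f h" "\<And>c h. f (hscale c h) = hscale c (f h)"
  shows "hlinear f"
  using assms by unfold_locales

lemma subspace_hecke: "hecke_module.subspace (hecke n)"
  by (simp add: hecke_module.subspace_def hecke_def)

lemmas hecke_closed [simp] =
  hecke_module.subspace_add[OF subspace_hecke] hecke_module.subspace_scale[OF subspace_hecke]

lemma hecke_eqI:
  "g \<in> hecke n \<Longrightarrow> h \<in> hecke n \<Longrightarrow> (\<And>v. v \<in> perms n \<Longrightarrow> g v = h v) \<Longrightarrow> g = h"
  by (force simp: hecke_def)

lemma hbasis_in_hecke [simp]: "w \<in> perms n \<Longrightarrow> hbasis w \<in> hecke n"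
  by (auto simp: hecke_def hbasis_def)

lemma hone_in_hecke [simp]: "hone \<in> hecke n"
  by (simp add: hone_def)

lemma one_lam_in_hecke [simp]: "one_lam n lam \<in> hecke n"
  by (simp add: one_lam_def hecke_def stab_def)

lemma hpar_in_hecke: "h \<in> hpar n lam \<Longrightarrow> h \<in> hecke n"
  by (simp add: hpar_def)

lemma hecke_basis_expansion:
  assumes "h \<in> hecke n" shows "h = (\<Sum>w\<in>perms n. hscale (h w) (hbasis w))"
proof (rule ext)
  fix v
  have "(\<Sum>w\<in>perms n. hscale (h w) (hbasis w)) v = (\<Sum>w\<in>perms n. if v = w then h w else 0)"
    unfolding sum_fun_apply by (intro sum.cong) (simp_all add: hbasis_def)
  then show "h v = (\<Sum>w\<in>perms n. hscale (h w) (hbasis w)) v"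
    using assms by (simp add: hecke_def)
qed

lemma hlinear_eq_on_basis:
  assumes "hlinear f" "hlinear g" "\<And>w. w \<in> perms n \<Longrightarrow> f (hbasis w) = g (hbasis w)" "h \<in> hecke n"
  shows "f h = g h"
proof -
  have expand: "k h = (\<Sum>w\<in>perms n. hscale (h w) (k (hbasis w)))" if "hlinear k" for k
    by (subst hecke_basis_expansion[OF assms(4)])
       (simp only: module_hom.sum[OF that] module_hom.scale[OF that])
  show ?thesis by (simp add: expand[OF assms(1)] expand[OF assms(2)] assms(3))
qed

locale hecke_algebra =
  fixes t :: "'a::comm_ring_1" and n :: nat
begin

abbreviation lmult :: "nat \<Rightarrow> 'a hecke \<Rightarrow> 'a hecke" where
  "lmult \<equiv> hgen_mult t n"

abbreviation lmult_word :: "nat list \<Rightarrow> 'a hecke \<Rightarrow> 'a hecke" where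
  "lmult_word \<equiv> foldr lmult"

abbreviation lmult_perm :: "(nat \<Rightarrow> nat) \<Rightarrow> 'a hecke \<Rightarrow> 'a hecke" where
  "lmult_perm \<equiv> hbasis_mult t n"

text \<open>This is \<open>h \<mapsto> t T\<^sub>i\<^sup>-\<^sup>1 h\<close>, written so that it makes sense before \<open>t\<close> is known to be a unit.\<close>

definition lmult_bar :: "nat \<Rightarrow> 'a hecke \<Rightarrow> 'a hecke" where
  "lmult_bar i h = lmult i h + hscale (1 - t) h"

definition rmult :: "nat \<Rightarrow> 'a hecke \<Rightarrow> 'a hecke" where
  "rmult j h = (\<lambda>v. if v \<in> perms n then
      (if descent v j then h (v \<circ> sgen j) + (t - 1) * h v else t * h (v \<circ> sgen j)) else 0)"

lemma lmult_apply:
  assumes "v \<in> perms n" "i \<in> {1..<n}"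
  shows "lmult i h v =
    (if descent (inv v) i then h (sgen i \<circ> v) + (t - 1) * h v else t * h (sgen i \<circ> v))"
  using assms by (simp add: hgen_mult_def len_sgen_comp_less_iff)

lemma lmult_in_hecke [simp]: "lmult i h \<in> hecke n"
  by (simp add: hecke_def hgen_mult_def)

lemma lmult_bar_in_hecke [simp]: "h \<in> hecke n \<Longrightarrow> lmult_bar i h \<in> hecke n"
  by (simp add: lmult_bar_def)

lemma rmult_in_hecke [simp]: "rmult j h \<in> hecke n"
  by (simp add: hecke_def rmult_def)

sublocale lmult: module_hom hscale hscale "lmult i" for i
  by (rule hlinearI) (auto simp: hgen_mult_def fun_eq_iff algebra_simps)

lemma lmult_quadratic:
  assumes h: "h \<in> hecke n" and i: "i \<in> {1..<n}"
  shows "lmult i (lmult i h) = hscale (t - 1) (lmult i h) + hscale t h"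
proof (rule hecke_eqI[where n = n])
  fix v assume v: "v \<in> perms n"
  then have sv: "sgen i \<circ> v \<in> perms n" using i by simp
  show "lmult i (lmult i h) v = (hscale (t - 1) (lmult i h) + hscale t h) v"
    using v i by (simp add: lmult_apply[OF v i] lmult_apply[OF sv i] descent_inv_sgen_comp_iff
        algebra_simps)
qed (use h in simp_all)

lemma lmult_lmult_bar:
  assumes "h \<in> hecke n" "i \<in> {1..<n}"
  shows "lmult i (lmult_bar i h) = hscale t h"
  unfolding lmult_bar_def lmult.add lmult.scale lmult_quadratic[OF assms]
  by (simp add: hecke_module.scale_left_diff_distrib)

lemma lmult_bar_lmult:
  assumes "h \<in> hecke n" "i \<in> {1..<n}"
  shows "lmult_bar i (lmult i h) = hscale t h"
  by (simp add: lmult_bar_def lmult_quadratic[OF assms] hecke_module.scale_left_diff_distrib)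

lemma lmult_eq_translate:
  assumes h: "h \<in> hecke n" and i: "i \<in> {1..<n}"
    and ascent: "\<And>w. w \<in> perms n \<Longrightarrow> h w \<noteq> 0 \<Longrightarrow> \<not> descent (inv w) i"
  shows "lmult i h = (\<lambda>w. h (sgen i \<circ> w))"
proof (rule hecke_eqI[where n = n])
  show "(\<lambda>w. h (sgen i \<circ> w)) \<in> hecke n" using h i by (simp add: hecke_def)
  fix v assume v: "v \<in> perms n"
  have "descent (inv v) i \<Longrightarrow> h v = 0" using ascent[OF v] by blast
  moreover have "\<not> descent (inv v) i \<Longrightarrow> h (sgen i \<circ> v) = 0"
    using ascent[of "sgen i \<circ> v"] v i by (auto simp: descent_inv_sgen_comp_iff)
  ultimately show "lmult i h v = h (sgen i \<circ> v)" by (auto simp: lmult_apply[OF v i])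
qed simp

lemma lmult_hbasis:
  assumes w: "w \<in> perms n" and i: "i \<in> {1..<n}" and "\<not> descent (inv w) i"
  shows "lmult i (hbasis w) = hbasis (sgen i \<circ> w)"
proof -
  have "lmult i (hbasis w) = (\<lambda>v. hbasis w (sgen i \<circ> v))"
    using assms
    by (intro lmult_eq_translate hbasis_in_hecke) (auto simp: hbasis_def split: if_splits)
  moreover have "sgen i \<circ> v = w \<longleftrightarrow> v = sgen i \<circ> w" for v by (metis sgen_comp_sgen_comp)
  ultimately show ?thesis by (simp add: hbasis_def)
qed

lemma rmult_hbasis:
  assumes w: "w \<in> perms n" and j: "j \<in> {1..<n}" and ascent: "\<not> descent w j"
  shows "rmult j (hbasis w) = hbasis (w \<circ> sgen j)"
proof (rule hecke_eqI[where n = n])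
  fix v assume v: "v \<in> perms n"
  have "v \<circ> sgen j = w \<longleftrightarrow> v = w \<circ> sgen j" by (metis comp_sgen_comp_sgen)
  moreover have "descent (w \<circ> sgen j) j" using w ascent by (simp add: descent_comp_sgen_iff)
  ultimately show "rmult j (hbasis w) v = hbasis (w \<circ> sgen j) v"
    using v ascent by (auto simp: rmult_def hbasis_def)
qed (use w j in simp_all)

lemma lmult_eq_rmult:
  assumes v: "v \<in> perms n" and i: "i \<in> {1..<n}" and swap: "{v j, v (Suc j)} = {i, Suc i}"
  shows "lmult i h v = rmult j h v"
proof -
  have "sgen i \<circ> v = v \<circ> sgen j"
    using sgen_comp_eq_comp_sgen[OF perms_bij[OF v] swap] .
  moreover have "descent (inv v) i \<longleftrightarrow> descent v j"
    using swap perms_inv_apply[OF v, of j] perms_inv_apply[OF v, of "Suc j"]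
    by (auto simp: descent_def doubleton_eq_iff)
  ultimately show ?thesis using v by (simp add: lmult_apply[OF v i] rmult_def)
qed

lemma lmult_rmult_commute:
  assumes i: "i \<in> {1..<n}" and j: "j \<in> {1..<n}"
  shows "lmult i (rmult j h) = rmult j (lmult i h)"
proof (rule hecke_eqI[where n = n])
  fix v assume v: "v \<in> perms n"
  have sv: "sgen i \<circ> v \<in> perms n" and vs: "v \<circ> sgen j \<in> perms n" using i j v by simp_all
  note mult_apply = lmult_apply[OF v i] lmult_apply[OF vs i] rmult_def
  show "lmult i (rmult j h) v = rmult j (lmult i h) v"
  proof (cases "{v j, v (Suc j)} = {i, Suc i}")
    case swap: True
    have "sgen i \<circ> v = v \<circ> sgen j"
      using sgen_comp_eq_comp_sgen[OF perms_bij[OF v] swap] .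
    moreover have "{(v \<circ> sgen j) j, (v \<circ> sgen j) (Suc j)} = {i, Suc i}"
      using swap by (simp add: sgen_apply insert_commute)
    then have "rmult j h (v \<circ> sgen j) = lmult i h (v \<circ> sgen j)"
      by (rule lmult_eq_rmult[OF vs i, symmetric])
    moreover have "rmult j h v = lmult i h v" and "lmult i (rmult j h) v = rmult j (rmult j h) v"
      using lmult_eq_rmult[OF v i swap] by simp_all
    ultimately show ?thesis
      using v by (simp add: rmult_def[of j "lmult i h"] rmult_def[of j "rmult j h"])
  next
    case generic: False
    have "descent (sgen i \<circ> v) j \<longleftrightarrow> descent v j"
      using sgen_less_iff[of "v (Suc j)" "v j" i] generic perms_inj[OF v]
      by (simp add: descent_def insert_commute inj_eq)
    moreover have "{inv v i, inv v (Suc i)} \<noteq> {j, Suc j}"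
      using generic perms_apply_inv[OF v, of i] perms_apply_inv[OF v, of "Suc i"]
      by (auto simp: doubleton_eq_iff)
    then have "descent (inv (v \<circ> sgen j)) i \<longleftrightarrow> descent (inv v) i"
      using sgen_less_iff[of "inv v (Suc i)" "inv v i" j] perms_inj[OF inv_in_perms[OF v]]
      by (simp add: inv_comp_sgen[OF v j] descent_def insert_commute inj_eq)
    ultimately show ?thesis using v sv vs by (simp add: mult_apply comp_assoc algebra_simps)
  qed
qed simp_all

lemma hlinear_lmult_word: "hlinear (lmult_word is)"
proof (induction "is")
  case (Cons i "is")
  show ?case
    unfolding foldr.simps(2) by (rule module_hom_compose[OF Cons.IH lmult.module_hom_axioms])
next
  case Nil
  show ?case unfolding foldr.simps(1) by (rule hecke_module.module_hom_id)
qed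

lemma lmult_word_in_hecke [simp]: "h \<in> hecke n \<Longrightarrow> lmult_word is h \<in> hecke n"
  by (cases "is") auto

lemma lmult_word_rmult_commute:
  "set is \<subseteq> {1..<n} \<Longrightarrow> j \<in> {1..<n} \<Longrightarrow> lmult_word is (rmult j h) = rmult j (lmult_word is h)"
  by (induction "is") (auto simp: lmult_rmult_commute)

lemma lmult_word_hone: "reduced_word n w is \<Longrightarrow> lmult_word is hone = hbasis w"
proof (induction "is" arbitrary: w)
  case Nil
  then have "lmult_word [] hone = hbasis w" by (simp add: reduced_word_iff hone_def)
  then show ?case .
next
  case (Cons i "is")
  note red = reduced_word_ConsD[OF Cons.prems]
  have "word_perm is \<in> perms n" using red(2) by (simp add: reduced_word_iff word_perm_in_perms)
  then have "lmult i (hbasis (word_perm is)) = hbasis (sgen i \<circ> word_perm is)"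
    using red(1,3) by (intro lmult_hbasis)
  then have "lmult_word (i # is) hone = hbasis w"
    using Cons.IH[OF red(2)] Cons.prems by (simp add: reduced_word_iff)
  then show ?case .
qed

text \<open>An operator commuting with right multiplication is determined by its value at the unit; this
  makes the choice of a reduced word in \<^const>\<open>hbasis_mult\<close> irrelevant without any appeal to
  Matsumoto's theorem.\<close>

lemma hlinear_eq_if_commutes_rmult:
  assumes lin: "hlinear f" "hlinear g"
    and f: "\<And>j h. j \<in> {1..<n} \<Longrightarrow> f (rmult j h) = rmult j (f h)"
    and g: "\<And>j h. j \<in> {1..<n} \<Longrightarrow> g (rmult j h) = rmult j (g h)"
    and unit: "f hone = g hone" and h: "h \<in> hecke n"
  shows "f h = g h"
  using lin _ h
proof (rule hlinear_eq_on_basis)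
  fix w assume "w \<in> perms n"
  then show "f (hbasis w) = g (hbasis w)"
  proof (induction rule: perms_induct)
    case id
    show ?case using unit by (simp only: hone_def)
  next
    case (comp_sgen w j)
    then show ?case using f g rmult_hbasis[OF comp_sgen.hyps] by metis
  qed
qed

lemma lmult_perm_reduced:
  assumes red: "reduced_word n w is" and h: "h \<in> hecke n"
  shows "lmult_perm w h = lmult_word is h"
  unfolding hbasis_mult_def
proof (rule hlinear_eq_if_commutes_rmult[OF hlinear_lmult_word hlinear_lmult_word _ _ _ h])
  let ?js = "SOME is. reduced_word n w is"
  have red': "reduced_word n w ?js" using red by (rule someI)
  show "lmult_word ?js hone = lmult_word is hone"
    using lmult_word_hone[OF red] lmult_word_hone[OF red'] by simp
  show "lmult_word ?js (rmult j x) = rmult j (lmult_word ?js x)" if "j \<in> {1..<n}" for j x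
    using red' that by (simp add: reduced_word_iff lmult_word_rmult_commute)
  show "lmult_word is (rmult j x) = rmult j (lmult_word is x)" if "j \<in> {1..<n}" for j x
    using red that by (simp add: reduced_word_iff lmult_word_rmult_commute)
qed

sublocale lmult_perm: module_hom hscale hscale "lmult_perm w" for w
  unfolding hbasis_mult_def[abs_def] by (rule hlinear_lmult_word)

lemma lmult_perm_in_hecke [simp]: "h \<in> hecke n \<Longrightarrow> lmult_perm w h \<in> hecke n"
  by (simp add: hbasis_mult_def)

lemma lmult_perm_id: "h \<in> hecke n \<Longrightarrow> lmult_perm id h = h"
  using lmult_perm_reduced[of id "[]"] by (simp add: reduced_word_iff)

lemma lmult_perm_sgen_comp:
  assumes w: "w \<in> perms n" and i: "i \<in> {1..<n}" and ascent: "\<not> descent (inv w) i"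
    and h: "h \<in> hecke n"
  shows "lmult_perm (sgen i \<circ> w) h = lmult i (lmult_perm w h)"
proof -
  obtain "is" where red: "reduced_word n w is" using reduced_word_exists[OF w] .
  then have "reduced_word n (sgen i \<circ> w) (i # is)"
    using len_sgen_comp_ascent[OF w i ascent] i by (simp add: reduced_word_iff)
  then show ?thesis using lmult_perm_reduced[OF _ h] red by simp
qed

lemma lmult_perm_comp_sgen:
  assumes w: "w \<in> perms n" and i: "i \<in> {1..<n}" and ascent: "\<not> descent w i"
    and h: "h \<in> hecke n"
  shows "lmult_perm (w \<circ> sgen i) h = lmult_perm w (lmult i h)"
proof -
  obtain "is" where red: "reduced_word n w is" using reduced_word_exists[OF w] .
  then have "reduced_word n (w \<circ> sgen i) (is @ [i])"
    using len_comp_sgen_ascent[OF w i ascent] i by (simp add: reduced_word_iff word_perm_append)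
  then show ?thesis
    using lmult_perm_reduced[OF _ h] lmult_perm_reduced[OF red lmult_in_hecke] by simp
qed

lemma lmult_perm_sgen:
  assumes "i \<in> {1..<n}" "h \<in> hecke n" shows "lmult_perm (sgen i) h = lmult i h"
  using lmult_perm_sgen_comp[of id i h] assms by (simp add: lmult_perm_id descent_def)

lemma hmult_hbasis:
  assumes w: "w \<in> perms n" shows "hmult t n (hbasis w) h = lmult_perm w h"
proof (rule ext)
  fix v
  have "hmult t n (hbasis w) h v = (\<Sum>u\<in>perms n. if u = w then lmult_perm u h v else 0)"
    unfolding hmult_def hbasis_def by (intro sum.cong) auto
  then show "hmult t n (hbasis w) h v = lmult_perm w h v" using w by simp
qed

lemma hmult_hone: "h \<in> hecke n \<Longrightarrow> hmult t n hone h = h"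
  by (simp add: hone_def hmult_hbasis lmult_perm_id)

lemma hmult_in_hecke [simp]: "h \<in> hecke n \<Longrightarrow> hmult t n g h \<in> hecke n"
  using lmult_perm_in_hecke by (simp add: hmult_def hecke_def)

sublocale hmult_right: module_hom hscale hscale "hmult t n g" for g
  by (rule hlinearI)
     (simp_all add: hmult_def fun_eq_iff lmult_perm.add lmult_perm.scale algebra_simps
       sum.distrib sum_distrib_left)

sublocale hmult_left: module_hom hscale hscale "\<lambda>g. hmult t n g h" for h
  by (rule hlinearI)
     (simp_all add: hmult_def fun_eq_iff algebra_simps sum.distrib sum_distrib_left)

lemma hmult_lmult:
  assumes i: "i \<in> {1..<n}" and g: "g \<in> hecke n" and h: "h \<in> hecke n"
  shows "hmult t n (lmult i g) h = lmult i (hmult t n g h)"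
proof (rule hlinear_eq_on_basis[OF _ _ _ g, where f = "\<lambda>g. hmult t n (lmult i g) h"])
  show "hlinear (\<lambda>g. hmult t n (lmult i g) h)" "hlinear (\<lambda>g. lmult i (hmult t n g h))"
    using module_hom_compose[OF lmult.module_hom_axioms hmult_left.module_hom_axioms]
      module_hom_compose[OF hmult_left.module_hom_axioms lmult.module_hom_axioms]
    by (simp_all add: o_def)
  have ascent: "hmult t n (lmult i (hbasis w)) h = lmult i (hmult t n (hbasis w) h)"
    if "w \<in> perms n" "\<not> descent (inv w) i" for w
    using that i h
    by (simp add: lmult_hbasis hmult_hbasis lmult_perm_sgen_comp del: atLeastLessThan_iff)
  fix w assume w: "w \<in> perms n"
  show "hmult t n (lmult i (hbasis w)) h = lmult i (hmult t n (hbasis w) h)"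
  proof (cases "descent (inv w) i")
    case True
    let ?v = "sgen i \<circ> w"
    have v: "?v \<in> perms n" "\<not> descent (inv ?v) i"
      using w i True by (simp_all add: descent_inv_sgen_comp_iff)
    then have w_eq: "hbasis w = lmult i (hbasis ?v)" using lmult_hbasis[OF v(1) i v(2)] by simp
    have "hmult t n (lmult i (lmult i (hbasis ?v))) h
        = hscale (t - 1) (hmult t n (lmult i (hbasis ?v)) h) + hscale t (hmult t n (hbasis ?v) h)"
      using v(1) i
      by (simp add: lmult_quadratic hmult_left.add hmult_left.scale del: atLeastLessThan_iff)
    also have "\<dots> = lmult i (lmult i (hmult t n (hbasis ?v) h))"
      unfolding ascent[OF v] using h i by (simp only: lmult_quadratic hmult_in_hecke)
    also have "\<dots> = lmult i (hmult t n (lmult i (hbasis ?v)) h)" by (simp only: ascent[OF v])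
    finally show ?thesis unfolding w_eq .
  next
    case False
    with w show ?thesis by (rule ascent)
  qed
qed

lemma hmult_lmult_perm:
  assumes w: "w \<in> perms n" and g: "g \<in> hecke n" and h: "h \<in> hecke n"
  shows "hmult t n (lmult_perm w g) h = lmult_perm w (hmult t n g h)"
proof -
  obtain "is" where red: "reduced_word n w is" using reduced_word_exists[OF w] .
  then have "set is \<subseteq> {1..<n}" by (simp add: reduced_word_iff)
  then have "hmult t n (lmult_word is g) h = lmult_word is (hmult t n g h)"
    using g h by (induction "is") (auto simp: hmult_lmult)
  then show ?thesis using g h by (simp add: lmult_perm_reduced[OF red])
qed

section \<open>Components at columns\<close>

definition column_comp :: "nat set \<Rightarrow> 'a hecke \<Rightarrow> 'a hecke" where
  "column_comp C h = (\<lambda>v. if v \<in> stab n (varpi (card C)) then h (uC n C \<circ> v) else 0)"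

lemma column_comp_in_hecke [simp]: "column_comp C h \<in> hecke n"
  by (auto simp: column_comp_def hecke_def stab_in_perms)

lemma column_comp_in_hpar: "C \<in> cols n l \<Longrightarrow> column_comp C h \<in> hpar n (varpi l)"
  by (simp add: hpar_def) (simp add: column_comp_def column_card)

sublocale column_comp: module_hom hscale hscale "column_comp C" for C
  by (rule hlinearI) (auto simp: column_comp_def fun_eq_iff)

lemma hpar_translate_eq_0:
  assumes "C \<in> cols n l" "g \<in> hpar n (varpi l)" "w ` {1..l} \<noteq> C"
  shows "g (inv (uC n C) \<circ> w) = 0"
proof (cases "w \<in> perms n")
  case True
  then show ?thesis using inv_uC_comp_in_stab_iff[OF assms(1) True] assms by (simp add: hpar_def)
next
  case False
  then show ?thesis
    using inv_comp_in_perms_iff[OF uC_in_perms[OF assms(1)]] hpar_in_hecke[OF assms(2)]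
    by (simp add: hecke_def)
qed

lemma lmult_perm_uC:
  assumes C: "C \<in> cols n l" and g: "g \<in> hpar n (varpi l)"
  shows "lmult_perm (uC n C) g = (\<lambda>w. g (inv (uC n C) \<circ> w))"
  using C
proof (induction rule: cols_induct)
  case highest
  show ?case
    using lmult_perm_id[OF hpar_in_hecke[OF g]] uC_atLeastAtMost[OF column_length_le[OF C]]
    by (simp only: inv_id id_o)
next
  case (scol C j)
  note u = uC_in_perms[OF scol(1)] and ascent = not_descent_inv_uC[OF scol(1-4)]
  let ?f = "\<lambda>w. g (inv (uC n C) \<circ> w)"
  have f: "?f \<in> hecke n"
    using hpar_in_hecke[OF g] by (simp add: hecke_def inv_comp_in_perms_iff[OF u])
  have "lmult_perm (uC n (scol j C)) g = lmult j (lmult_perm (uC n C) g)"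
    unfolding uC_scol[OF scol(1-4)]
    by (rule lmult_perm_sgen_comp[OF u scol(2) ascent hpar_in_hecke[OF g]])
  also have "\<dots> = lmult j ?f" by (rule arg_cong[OF scol.IH])
  also have "\<dots> = (\<lambda>w. ?f (sgen j \<circ> w))"
  proof (rule lmult_eq_translate[OF f scol(2)])
    fix w assume w: "w \<in> perms n" "?f w \<noteq> 0"
    then have "w ` {1..l} = C" using hpar_translate_eq_0[OF scol(1) g] by blast
    then show "\<not> descent (inv w) j"
      using not_descent_inv_if_image[OF w(1)] scol(2-4) by (metis Suc_leI atLeastLessThan_iff)
  qed
  finally show ?case
    unfolding uC_scol[OF scol(1-4)] inv_sgen_comp[OF u scol(2)] comp_assoc .
qed

lemma sum_lmult_perm_uC_apply:
  assumes f: "\<And>F. F \<in> cols n l \<Longrightarrow> f F \<in> hpar n (varpi l)"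
    and w: "w \<in> perms n" and l: "l \<le> n"
  shows "(\<Sum>F\<in>cols n l. lmult_perm (uC n F) (f F)) w
    = f (w ` {1..l}) (inv (uC n (w ` {1..l})) \<circ> w)"
proof -
  let ?C = "w ` {1..l}"
  have "(\<Sum>F\<in>cols n l. lmult_perm (uC n F) (f F)) w
      = (\<Sum>F\<in>cols n l. if F = ?C then f F (inv (uC n F) \<circ> w) else 0)"
    unfolding sum_fun_apply
  proof (intro sum.cong refl)
    fix F assume F: "F \<in> cols n l"
    show "lmult_perm (uC n F) (f F) w = (if F = ?C then f F (inv (uC n F) \<circ> w) else 0)"
      unfolding lmult_perm_uC[OF F f[OF F]] using hpar_translate_eq_0[OF F f[OF F]] by metis
  qed
  then show ?thesis using perms_image_in_cols[OF w l] by simp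
qed

lemma hecke_eq_sum_column_comp:
  assumes h: "h \<in> hecke n" and l: "l \<le> n"
  shows "h = (\<Sum>F\<in>cols n l. lmult_perm (uC n F) (column_comp F h))" (is "_ = ?sum")
proof (rule hecke_eqI[OF h])
  show "?sum \<in> hecke n"
    by (rule hecke_module.subspace_sum[OF subspace_hecke]) simp
  fix w assume w: "w \<in> perms n"
  let ?C = "w ` {1..l}"
  note C = perms_image_in_cols[OF w l]
  have "?sum w = column_comp ?C h (inv (uC n ?C) \<circ> w)"
    by (rule sum_lmult_perm_uC_apply[OF column_comp_in_hpar w l])
  also have "\<dots> = h (uC n ?C \<circ> (inv (uC n ?C) \<circ> w))"
    using inv_uC_comp_in_stab_iff[OF C w] column_card[OF C]
    by (simp only: column_comp_def refl if_True)
  also have "\<dots> = h w" by (simp only: o_assoc perms_comp_inv[OF uC_in_perms[OF C]] id_o)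
  finally show "h w = ?sum w" ..
qed

lemma column_comp_sum:
  assumes f: "\<And>F. F \<in> cols n l \<Longrightarrow> f F \<in> hpar n (varpi l)" and C: "C \<in> cols n l"
  shows "column_comp C (\<Sum>F\<in>cols n l. lmult_perm (uC n F) (f F)) = f C"
    (is "column_comp C ?sum = _")
proof (rule ext)
  fix v
  show "column_comp C ?sum v = f C v"
  proof (cases "v \<in> stab n (varpi l)")
    case True
    note u = uC_comp_stab_in_perms[OF C True] and image = uC_comp_stab_image[OF C True]
    have "?sum (uC n C \<circ> v) = f C (inv (uC n C) \<circ> (uC n C \<circ> v))"
      using sum_lmult_perm_uC_apply[OF f u column_length_le[OF C]] unfolding image .
    also have "\<dots> = f C v" by (simp only: o_assoc perms_inv_comp[OF uC_in_perms[OF C]] id_o)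
    finally show ?thesis using True column_card[OF C] by (simp only: column_comp_def if_True)
  next
    case False
    then show ?thesis using f[OF C] column_card[OF C] by (simp add: column_comp_def hpar_def)
  qed
qed

lemma component_eq_column_comp:
  assumes C: "C \<in> cols n l" and h: "h \<in> hecke n"
  shows "component t n l h C = column_comp C h"
proof -
  have sum_eq: "hsum (\<lambda>F. hmult t n (hbasis (uC n F)) (f F)) (cols n l)
      = (\<Sum>F\<in>cols n l. lmult_perm (uC n F) (f F))" for f
    unfolding hsum_eq_sum by (intro sum.cong refl hmult_hbasis uC_in_perms)
  define comps where "comps = (\<lambda>F. if F \<in> cols n l then column_comp F h else hzero)"
  have "component t n l h = comps"
    unfolding component_def sum_eq
  proof (rule the_equality, intro conjI)
    show "\<forall>F\<in>cols n l. comps F \<in> hpar n (varpi l)"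
      using column_comp_in_hpar by (simp add: comps_def)
    show "\<forall>F. F \<notin> cols n l \<longrightarrow> comps F = hzero" by (simp add: comps_def)
    show "h = (\<Sum>F\<in>cols n l. lmult_perm (uC n F) (comps F))"
      using hecke_eq_sum_column_comp[OF h column_length_le[OF C]] by (simp add: comps_def)
  next
    fix f assume f: "(\<forall>F\<in>cols n l. f F \<in> hpar n (varpi l)) \<and> (\<forall>F. F \<notin> cols n l \<longrightarrow> f F = hzero)
      \<and> h = (\<Sum>F\<in>cols n l. lmult_perm (uC n F) (f F))"
    then have "column_comp F h = f F" if "F \<in> cols n l" for F
      using column_comp_sum[of l f F] that by metis
    then show "f = comps" using f by (auto simp: comps_def)
  qed
  then show ?thesis using C by (simp add: comps_def)
qed

lemma column_comp_lmult:
  assumes C: "C \<in> cols n l" and j: "j \<in> {1..<n}" "j \<in> C" "Suc j \<notin> C"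
  shows "column_comp C (lmult j h) = hscale t (column_comp (scol j C) h)"
proof (rule ext)
  fix v
  note card_C = column_card[OF C]
  show "column_comp C (lmult j h) v = hscale t (column_comp (scol j C) h) v"
  proof (cases "v \<in> stab n (varpi l)")
    case True
    note u = uC_comp_stab_in_perms[OF C True]
    have "\<not> descent (inv (uC n C \<circ> v)) j"
      using not_descent_inv_if_image[OF u, of j l] j unfolding uC_comp_stab_image[OF C True] by simp
    then show ?thesis
      using True
      by (simp add: column_comp_def card_C lmult_apply[OF u j(1)] uC_scol[OF C j] comp_assoc)
  qed (simp add: column_comp_def card_C)
qed

lemma column_comp_lmult_bar:
  assumes C: "C \<in> cols n l" and j: "j \<in> {1..<n}" "j \<notin> C" "Suc j \<in> C"
  shows "column_comp C (lmult_bar j h) = column_comp (scol j C) h"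
proof (rule ext)
  fix v
  note card_C = column_card[OF C]
  have S: "scol j C \<in> cols n l" using C j(1) by (rule scol_in_cols)
  show "column_comp C (lmult_bar j h) v = column_comp (scol j C) h v"
  proof (cases "v \<in> stab n (varpi l)")
    case True
    note u = uC_comp_stab_in_perms[OF C True] and uS = uC_comp_stab_in_perms[OF S True]
    have u_eq: "uC n C \<circ> v = sgen j \<circ> (uC n (scol j C) \<circ> v)"
      using uC_scol[OF S j(1)] j by (simp add: comp_assoc)
    have "\<not> descent (inv (uC n (scol j C) \<circ> v)) j"
      using not_descent_inv_if_image[OF uS, of j l] j
      unfolding uC_comp_stab_image[OF S True] by simp
    then have "descent (inv (uC n C \<circ> v)) j"
      unfolding u_eq using descent_inv_sgen_comp_iff[OF uS j(1)] by blast
    then show ?thesis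
      using True
      by (simp add: column_comp_def card_C lmult_bar_def lmult_apply[OF u j(1)] algebra_simps)
         (simp add: u_eq)
  qed (simp add: column_comp_def card_C)
qed

lemma column_comp_lmult_consecutive:
  assumes C: "C \<in> cols n l" and j: "j \<in> {1..<n}"
    and i: "i \<in> {1..<n}" "i \<noteq> l" "uC n C i = j" "uC n C (Suc i) = Suc j"
  shows "column_comp C (lmult j h) = lmult i (column_comp C h)"
proof (rule hecke_eqI[where n = n])
  fix v assume v: "v \<in> perms n"
  note uC = uC_in_perms[OF C] and card_C = column_card[OF C]
  have "varpi l i = varpi l (Suc i)" using i(2) by (simp add: varpi_def)
  then have stab: "sgen i \<circ> v \<in> stab n (varpi l) \<longleftrightarrow> v \<in> stab n (varpi l)"
    by (rule sgen_comp_in_stab_iff[OF i(1)])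
  show "column_comp C (lmult j h) v = lmult i (column_comp C h) v"
  proof (cases "v \<in> stab n (varpi l)")
    case True
    have "inv (uC n C) j = i" "inv (uC n C) (Suc j) = Suc i"
      using i(3,4) by (simp_all add: inv_f_eq[OF perms_inj[OF uC]])
    then have "descent (inv (uC n C \<circ> v)) j \<longleftrightarrow> descent (inv v) i"
      by (simp add: inv_comp_perms[OF uC v] descent_def)
    moreover have "sgen j \<circ> (uC n C \<circ> v) = uC n C \<circ> (sgen i \<circ> v)"
      using sgen_comp_eq_comp_sgen[OF perms_bij[OF uC], of i j] i by (simp add: o_assoc)
    ultimately show ?thesis
      using True stab
      by (simp add: column_comp_def card_C lmult_apply[OF uC_comp_stab_in_perms[OF C True] j]
          lmult_apply[OF v i(1)])
  next
    case False
    then show ?thesis using stab by (simp add: column_comp_def card_C lmult_apply[OF v i(1)])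
  qed
qed simp_all

end

section \<open>Invertible parameter\<close>

locale unit_hecke_algebra = hecke_algebra +
  assumes t_unit: "t dvd 1"
begin

lemma hscale_t_inverse:
  obtains t' where "\<And>h :: 'a hecke. hscale t' (hscale t h) = h"
proof -
  obtain t' where "1 = t * t'" using t_unit by (rule dvdE)
  then have "hscale t' (hscale t h) = h" for h :: "'a hecke"
    by (simp add: mult.commute[of t'] hecke_module.scale_scale)
  then show ?thesis using that by blast
qed

lemma bij_betw_lmult:
  assumes i: "i \<in> {1..<n}" shows "bij_betw (lmult i) (hecke n) (hecke n)"
proof -
  obtain t' where t': "\<And>h :: 'a hecke. hscale t' (hscale t h) = h" by (rule hscale_t_inverse) blast
  show ?thesis
  proof (rule bij_betwI[where g = "\<lambda>h. hscale t' (lmult_bar i h)"])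
    fix h :: "'a hecke" assume h: "h \<in> hecke n"
    show "hscale t' (lmult_bar i (lmult i h)) = h" using h i by (simp only: lmult_bar_lmult t')
    show "lmult i (hscale t' (lmult_bar i h)) = h"
      using h i by (simp only: lmult.scale lmult_lmult_bar t')
  qed auto
qed

lemma bij_betw_lmult_perm:
  assumes w: "w \<in> perms n" shows "bij_betw (lmult_perm w) (hecke n) (hecke n)"
proof -
  obtain "is" where red: "reduced_word n w is" using reduced_word_exists[OF w] .
  then have "set is \<subseteq> {1..<n}" by (simp add: reduced_word_iff)
  then have "bij_betw (lmult_word is) (hecke n) (hecke n)"
  proof (induction "is")
    case (Cons i "is")
    then show ?case unfolding foldr.simps(2) by (intro bij_betw_trans[OF _ bij_betw_lmult]) simp_all
  qed (simp add: bij_betw_def)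
  then show ?thesis by (subst bij_betw_cong[OF lmult_perm_reduced[OF red]])
qed

lemma lmult_perm_eqD:
  "w \<in> perms n \<Longrightarrow> g \<in> hecke n \<Longrightarrow> h \<in> hecke n \<Longrightarrow> lmult_perm w g = lmult_perm w h \<Longrightarrow> g = h"
  by (rule inj_onD[OF bij_betw_imp_inj_on[OF bij_betw_lmult_perm]])

lemma
  assumes w: "w \<in> perms n"
  shows hinv_hbasis_in_hecke: "hinv t n (hbasis w) \<in> hecke n"
    and lmult_perm_hinv_hbasis: "lmult_perm w (hinv t n (hbasis w)) = hone"
proof -
  obtain g where g: "g \<in> hecke n" "lmult_perm w g = hone"
    using bij_betw_imp_surj_on[OF bij_betw_lmult_perm[OF w]] hone_in_hecke by (metis imageE)
  have "lmult_perm w (hmult t n g (hbasis w)) = hbasis w"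
    using hmult_lmult_perm[OF w g(1), of "hbasis w"] w by (simp add: g(2) hmult_hone)
  also have "\<dots> = lmult_perm w hone"
    using reduced_word_exists[OF w] lmult_perm_reduced lmult_word_hone by (metis hone_in_hecke)
  finally have left_inverse: "hmult t n g (hbasis w) = hone"
    using lmult_perm_eqD[OF w] w by simp
  have "hinv t n (hbasis w) = g"
    unfolding hinv_def
  proof (rule the_equality)
    show "g \<in> hecke n \<and> hmult t n (hbasis w) g = hone \<and> hmult t n g (hbasis w) = hone"
      using g left_inverse by (simp add: hmult_hbasis[OF w])
    fix g' assume "g' \<in> hecke n \<and> hmult t n (hbasis w) g' = hone \<and> hmult t n g' (hbasis w) = hone"
    then show "g' = g" using lmult_perm_eqD[OF w, of g' g] g by (simp add: hmult_hbasis[OF w])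
  qed
  then show "hinv t n (hbasis w) \<in> hecke n" "lmult_perm w (hinv t n (hbasis w)) = hone"
    using g by simp_all
qed

lemma lmult_perm_hmult_hinv:
  assumes w: "w \<in> perms n" and h: "h \<in> hecke n"
  shows "lmult_perm w (hmult t n (hinv t n (hbasis w)) h) = h"
  using hmult_lmult_perm[OF w hinv_hbasis_in_hecke[OF w] h]
  by (simp add: lmult_perm_hinv_hbasis[OF w] hmult_hone[OF h])

definition lmult_bar_perm :: "(nat \<Rightarrow> nat) \<Rightarrow> 'a hecke \<Rightarrow> 'a hecke" where
  "lmult_bar_perm w h = hscale (t ^ len n w) (hmult t n (hinv t n (hbasis (inv w))) h)"

sublocale lmult_bar_perm: module_hom hscale hscale "lmult_bar_perm w" for w
  by (rule hlinearI)
     (simp_all add: lmult_bar_perm_def hmult_right.add hmult_right.scale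
       hecke_module.scale_right_distrib mult.commute del: hscale_apply)

lemma lmult_bar_perm_in_hecke [simp]: "h \<in> hecke n \<Longrightarrow> lmult_bar_perm w h \<in> hecke n"
  by (simp add: lmult_bar_perm_def)

lemma lmult_perm_inv_lmult_bar_perm:
  assumes "w \<in> perms n" "h \<in> hecke n"
  shows "lmult_perm (inv w) (lmult_bar_perm w h) = hscale (t ^ len n w) h"
  using assms by (simp add: lmult_bar_perm_def lmult_perm.scale lmult_perm_hmult_hinv)

lemma lmult_bar_perm_eqI:
  assumes "w \<in> perms n" "h \<in> hecke n" "x \<in> hecke n"
    and "lmult_perm (inv w) x = hscale (t ^ len n w) h"
  shows "lmult_bar_perm w h = x"
  by (rule lmult_perm_eqD[of "inv w"]) (use assms in \<open>simp_all add: lmult_perm_inv_lmult_bar_perm\<close>)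

lemma lmult_bar_perm_id: "h \<in> hecke n \<Longrightarrow> lmult_bar_perm id h = h"
  by (rule lmult_bar_perm_eqI) (simp_all add: lmult_perm_id)

lemma lmult_bar_perm_sgen_comp:
  assumes w: "w \<in> perms n" and i: "i \<in> {1..<n}" and ascent: "\<not> descent (inv w) i"
    and h: "h \<in> hecke n"
  shows "lmult_bar_perm (sgen i \<circ> w) h = lmult_bar i (lmult_bar_perm w h)"
proof (rule lmult_bar_perm_eqI)
  let ?x = "lmult_bar_perm w h"
  have "lmult_perm (inv (sgen i \<circ> w)) (lmult_bar i ?x)
      = lmult_perm (inv w) (lmult i (lmult_bar i ?x))"
    unfolding inv_sgen_comp[OF w i]
    by (rule lmult_perm_comp_sgen[OF inv_in_perms[OF w] i ascent]) (use h in simp)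
  also have "\<dots> = hscale t (lmult_perm (inv w) ?x)"
    using h i by (simp only: lmult_lmult_bar lmult_bar_perm_in_hecke lmult_perm.scale)
  also have "\<dots> = hscale (t ^ len n (sgen i \<circ> w)) h"
    by (simp add: lmult_perm_inv_lmult_bar_perm[OF w h] len_sgen_comp_ascent[OF w i ascent])
  finally show "lmult_perm (inv (sgen i \<circ> w)) (lmult_bar i ?x)
      = hscale (t ^ len n (sgen i \<circ> w)) h" .
qed (use w i h in simp_all)

lemma lmult_bar_perm_comp_sgen:
  assumes w: "w \<in> perms n" and i: "i \<in> {1..<n}" and ascent: "\<not> descent w i"
    and h: "h \<in> hecke n"
  shows "lmult_bar_perm (w \<circ> sgen i) h = lmult_bar_perm w (lmult_bar i h)"
proof (rule lmult_bar_perm_eqI)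
  let ?x = "lmult_bar_perm w (lmult_bar i h)"
  have "lmult_perm (inv (w \<circ> sgen i)) ?x = lmult i (lmult_perm (inv w) ?x)"
    unfolding inv_comp_sgen[OF w i]
    by (rule lmult_perm_sgen_comp[OF inv_in_perms[OF w] i])
       (use w ascent h in \<open>simp_all add: inv_inv_perms\<close>)
  also have "\<dots> = hscale (t ^ len n w) (lmult i (lmult_bar i h))"
    using w h by (simp only: lmult_perm_inv_lmult_bar_perm lmult_bar_in_hecke lmult.scale)
  also have "\<dots> = hscale (t ^ len n (w \<circ> sgen i)) h"
    by (simp add: lmult_lmult_bar[OF h i] len_comp_sgen_ascent[OF w i ascent] mult.commute)
  finally show "lmult_perm (inv (w \<circ> sgen i)) ?x = hscale (t ^ len n (w \<circ> sgen i)) h" .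
qed (use w i h in simp_all)

lemma hscale_hinv_sgen:
  assumes i: "i \<in> {1..<n}" and h: "h \<in> hecke n"
  shows "hscale t (hmult t n (hinv t n (hbasis (sgen i))) h) = lmult_bar i h"
proof -
  have "len n (sgen i) = 1" using len_sgen_comp_ascent[of id n i] i by (simp add: descent_def)
  then have "hscale t (hmult t n (hinv t n (hbasis (sgen i))) h) = lmult_bar_perm (sgen i \<circ> id) h"
    by (simp add: lmult_bar_perm_def)
  also have "\<dots> = lmult_bar i h"
    using i h by (subst lmult_bar_perm_sgen_comp) (simp_all add: descent_def lmult_bar_perm_id)
  finally show ?thesis .
qed

section \<open>Column operators\<close>

definition column_op :: "nat set \<Rightarrow> 'a hecke \<Rightarrow> 'a hecke" where
  "column_op C h = lmult_bar_perm (uC n C) (column_comp C h)"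

sublocale column_op: module_hom hscale hscale "column_op C" for C
  by (rule hlinearI)
     (simp_all add: column_op_def column_comp.add column_comp.scale lmult_bar_perm.add
       lmult_bar_perm.scale del: hscale_apply)

lemma column_op_in_hecke [simp]: "column_op C h \<in> hecke n"
  by (simp add: column_op_def)

lemma foldr_column_op_in_hecke [simp]: "h \<in> hecke n \<Longrightarrow> foldr column_op T h \<in> hecke n"
  by (cases T) simp_all

lemma lmult_bar_perm_uC_scol:
  assumes C: "C \<in> cols n l" and j: "j \<in> {1..<n}" "j \<in> C" "Suc j \<notin> C" and h: "h \<in> hecke n"
  shows "lmult_bar_perm (uC n (scol j C)) h = lmult_bar j (lmult_bar_perm (uC n C) h)"
  unfolding uC_scol[OF C j]
  by (rule lmult_bar_perm_sgen_comp[OF uC_in_perms[OF C] j(1) not_descent_inv_uC[OF C j] h])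

lemma column_op_lmult:
  assumes C: "C \<in> cols n l" and j: "j \<in> {1..<n}" "j \<in> C" "Suc j \<notin> C"
  shows "column_op C (lmult j h) = lmult j (column_op (scol j C) h)"
proof -
  let ?x = "column_comp (scol j C) h"
  have "column_op C (lmult j h) = hscale t (lmult_bar_perm (uC n C) ?x)"
    by (simp only: column_op_def column_comp_lmult[OF C j] lmult_bar_perm.scale)
  also have "\<dots> = lmult j (lmult_bar j (lmult_bar_perm (uC n C) ?x))"
    using j(1) by (simp add: lmult_lmult_bar)
  also have "\<dots> = lmult j (column_op (scol j C) h)"
    by (simp add: column_op_def lmult_bar_perm_uC_scol[OF C j])
  finally show ?thesis .
qed

lemma column_op_lmult_bar:
  assumes C: "C \<in> cols n l" and j: "j \<in> {1..<n}" "j \<notin> C" "Suc j \<in> C"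
  shows "column_op C (lmult_bar j h) = lmult_bar j (column_op (scol j C) h)"
  using lmult_bar_perm_uC_scol[OF scol_in_cols[OF C j(1)] j(1), of "column_comp (scol j C) h"] j
  by (simp add: column_op_def column_comp_lmult_bar[OF C j])

lemma column_op_lmult_bar_fixed:
  assumes C: "C \<in> cols n l" and j: "j \<in> {1..<n}" "j \<in> C \<longleftrightarrow> Suc j \<in> C"
  shows "column_op C (lmult_bar j h) = lmult_bar j (column_op C h)"
proof -
  obtain i where i: "i \<in> {1..<n}" "i \<noteq> l" "uC n C i = j" "uC n C (Suc i) = Suc j"
    using uC_consecutive_preimages[OF C j] .
  note u = uC_in_perms[OF C]
  let ?x = "column_comp C h"
  have "column_comp C (lmult_bar j h) = lmult_bar i ?x"
    by (simp only: lmult_bar_def column_comp.add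
        column_comp.scale column_comp_lmult_consecutive[OF C j(1) i])
  then have "column_op C (lmult_bar j h) = lmult_bar_perm (uC n C) (lmult_bar i ?x)"
    by (simp only: column_op_def)
  also have "\<dots> = lmult_bar_perm (uC n C \<circ> sgen i) ?x"
    using i by (intro lmult_bar_perm_comp_sgen[OF u, symmetric]) (simp_all add: descent_def)
  also have "uC n C \<circ> sgen i = sgen j \<circ> uC n C"
    using i by (intro sgen_comp_eq_comp_sgen[OF perms_bij[OF u], symmetric]) simp
  also have "lmult_bar_perm (sgen j \<circ> uC n C) ?x = lmult_bar j (column_op C h)"
  proof -
    have "inv (uC n C) j = i" "inv (uC n C) (Suc j) = Suc i"
      using i by (simp_all add: inv_f_eq[OF perms_inj[OF u]])
    then have "\<not> descent (inv (uC n C)) j" by (simp add: descent_def)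
    then show ?thesis
      unfolding column_op_def using j(1) by (intro lmult_bar_perm_sgen_comp[OF u]) simp_all
  qed
  finally show ?thesis .
qed

definition signed_lmult :: "int \<Rightarrow> nat \<Rightarrow> 'a hecke \<Rightarrow> 'a hecke" where
  "signed_lmult s j h = (if s = -1 then lmult j h else lmult_bar j h)"

lemma column_op_signed_lmult:
  assumes C: "C \<in> cols n l" and j: "j \<in> {1..<n}"
  shows "column_op C (signed_lmult (sigma j C) j h)
    = signed_lmult (sigma j C) j (column_op (scol j C) h)"
proof -
  consider (up) "j \<in> C" "Suc j \<notin> C" | (down) "j \<notin> C" "Suc j \<in> C"
    | (fixed) "j \<in> C \<longleftrightarrow> Suc j \<in> C" by blast
  then show ?thesis
  proof cases
    case up
    then show ?thesis using column_op_lmult[OF C j] by (simp add: signed_lmult_def sigma_def)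
  next
    case down
    then show ?thesis using column_op_lmult_bar[OF C j] by (simp add: signed_lmult_def sigma_def)
  next
    case fixed
    then show ?thesis
      using column_op_lmult_bar_fixed[OF C j fixed] scol_eq_self[OF fixed]
      by (simp add: signed_lmult_def sigma_def)
  qed
qed

lemma column_op_signed_lmult_switch:
  assumes "C \<in> cols n l" "j \<in> {1..<n}"
  shows "column_op C (signed_lmult (sigma j D) j h)
    = signed_lmult (sigma j C) j (column_op (scol j C) h)
      + (if sigma j D * sigma j C = -1
         then hscale (of_int (sigma j D) * (1 - t)) (column_op C h) else 0)"
proof -
  have "signed_lmult (sigma j D) j h = signed_lmult (sigma j C) j h
      + (if sigma j D * sigma j C = -1 then hscale (of_int (sigma j D) * (1 - t)) h else 0)"
    by (auto simp: signed_lmult_def sigma_def lmult_bar_def fun_eq_iff algebra_simps)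
  then show ?thesis
    by (simp add: column_op.add column_op.scale column_op_signed_lmult[OF assms] column_op.zero
        del: hscale_apply zero_fun_apply)
qed

lemma signed_lmult_sigma:
  assumes j: "j \<in> {1..<n}" and h: "h \<in> hecke n"
  shows "signed_lmult (sigma j C) j h = (if j \<in> C \<and> Suc j \<notin> C then hmult t n (hbasis (sgen j)) h
    else hscale t (hmult t n (hinv t n (hbasis (sgen j))) h))"
  using hmult_hbasis[OF sgen_in_perms[OF j]] lmult_perm_sgen[OF assms] hscale_hinv_sgen[OF assms]
  by (simp add: signed_lmult_def sigma_def)

text \<open>Starting the recursion with the sum of all \<open>T\<^sub>w\<close>, which is \<open>\<Psi>\<close> of the empty tableau as (b)
  would have it, makes the one-column case of \<open>\<Psi>\<close> an instance of the recursive one.\<close>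

definition Psi_fold :: "nat set list \<Rightarrow> 'a hecke" where
  "Psi_fold T = foldr column_op T (one_lam n (\<lambda>_. 0))"

lemma Psi_fold_simps:
  "Psi_fold [] = one_lam n (\<lambda>_. 0)" "Psi_fold (C # T) = column_op C (Psi_fold T)"
  by (simp_all add: Psi_fold_def)

lemma Psi_fold_append: "Psi_fold (T @ X) = foldr column_op T (Psi_fold X)"
  by (simp add: Psi_fold_def)

lemma Psi_fold_in_hecke [simp]: "Psi_fold T \<in> hecke n"
  by (simp add: Psi_fold_def)

lemma column_comp_one_lam_0:
  assumes "C \<subseteq> {1..n}"
  shows "column_comp C (one_lam n (\<lambda>_. 0)) = one_lam n (varpi (card C))"
  using uC_comp_stab_in_perms[OF subset_in_cols[OF assms]]
  by (auto simp: column_comp_def one_lam_def stab_def[of n "\<lambda>_. 0"] fun_eq_iff)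

lemma Psi_eq_Psi_fold:
  assumes "T \<noteq> []" "set T \<subseteq> Pow {1..n}"
  shows "Psi t n T = Psi_fold T"
  using assms
proof (induction T rule: list_nonempty_induct)
  case (single C)
  then show ?case
    by (simp add: Psi_fold_simps column_op_def lmult_bar_perm_def column_comp_one_lam_0)
next
  case (cons C T)
  obtain D S where T: "T = D # S" using cons.hyps by (cases T) auto
  have "component t n (card C) (Psi_fold T) C = column_comp C (Psi_fold T)"
    using cons.prems by (intro component_eq_column_comp subset_in_cols) simp_all
  then show ?case
    using cons.IH cons.prems unfolding T Psi.simps Psi_fold_simps(2)[of C]
    by (simp add: column_op_def lmult_bar_perm_def)
qed

section \<open>Vanishing on tableaux that are not semistandard\<close>

lemma gale_le_if_lmult_bar_perm_uC_neq_0: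
  assumes D: "D \<in> cols n m" and h: "h \<in> hpar n (varpi m)"
    and w: "w \<in> perms n" "lmult_bar_perm (uC n D) h w \<noteq> 0"
  shows "gale_le (w ` {1..m}) D"
  using D w
proof (induction arbitrary: w rule: cols_induct)
  case highest
  note m = column_length_le[OF D]
  have "h w \<noteq> 0"
    using highest(2) unfolding uC_atLeastAtMost[OF m] lmult_bar_perm_id[OF hpar_in_hecke[OF h]] .
  then have "w \<in> stab n (varpi m)" using h by (auto simp: hpar_def)
  then have "w ` {1..m} = {1..m}" using stab_varpi_iff[OF m] by blast
  then show ?case by (simp only: gale_le_refl)
next
  case (scol C j)
  let ?x = "lmult_bar_perm (uC n C) h"
  have sw: "sgen j \<circ> w \<in> perms n" using scol.hyps(2) scol.prems(1) by simp
  have "lmult_bar j ?x w \<noteq> 0"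
    using scol.prems(2) lmult_bar_perm_uC_scol[OF scol.hyps hpar_in_hecke[OF h]] by simp
  then have "?x w \<noteq> 0 \<or> ?x (sgen j \<circ> w) \<noteq> 0"
    by (auto simp: lmult_bar_def lmult_apply[OF scol.prems(1) scol.hyps(2)] split: if_splits)
  then consider (unmoved) "?x w \<noteq> 0" | (moved) "?x (sgen j \<circ> w) \<noteq> 0" by blast
  then show ?case
  proof cases
    case unmoved
    then have "gale_le (w ` {1..m}) C" by (rule scol.IH[OF scol.prems(1)])
    then show ?thesis using gale_le_scol[OF scol.hyps(3,4)] by (rule gale_le_trans)
  next
    case moved
    then have "gale_le ((sgen j \<circ> w) ` {1..m}) C" by (rule scol.IH[OF sw])
    then have "gale_le (scol j (w ` {1..m})) C" by (simp only: scol_eq_sgen_image image_comp)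
    then show ?thesis using scol.hyps(2,4) by (intro gale_le_scol_lift) simp_all
  qed
qed

lemma column_comp_column_op_eq_0:
  assumes C: "C \<in> cols n l" and D: "D \<in> cols n m" and "m \<le> l"
    and k: "k \<in> {1..m}" "entry D k < entry C k"
  shows "column_comp C (column_op D h) = 0"
proof (rule ccontr)
  assume "column_comp C (column_op D h) \<noteq> 0"
  then obtain v where "column_comp C (column_op D h) v \<noteq> 0" by (auto simp: fun_eq_iff)
  then have v: "v \<in> stab n (varpi l)" "column_op D h (uC n C \<circ> v) \<noteq> 0"
    using column_card[OF C] by (auto simp: column_comp_def split: if_splits)
  note u = uC_comp_stab_in_perms[OF C v(1)]
  have "gale_le ((uC n C \<circ> v) ` {1..m}) D"
    using v(2) unfolding column_op_def
    by (rule gale_le_if_lmult_bar_perm_uC_neq_0[OF D column_comp_in_hpar[OF D] u])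
  moreover have "(uC n C \<circ> v) ` {1..m} \<subseteq> (uC n C \<circ> v) ` {1..l}"
    using \<open>m \<le> l\<close> by (intro image_mono) simp
  then have "gale_le C ((uC n C \<circ> v) ` {1..m})"
    unfolding uC_comp_stab_image[OF C v(1)] by (rule gale_le_superset)
  ultimately have "gale_le C D" by (rule gale_le_trans[rotated])
  then have "entry C k \<le> entry D k"
    using k(1) \<open>m \<le> l\<close> column_card[OF C] column_card[OF D] column_finite[OF C] column_finite[OF D]
    by (intro gale_le_imp_entry_le) auto
  then show False using k(2) by simp
qed

lemma foldr_column_op_0: "foldr column_op T 0 = 0"
  by (induction T) (simp_all only: foldr.simps id_apply o_apply column_op.zero)

lemma Psi_fold_not_semistandard:
  assumes T: "tableau n T" and "\<not> semistandard T"
  shows "Psi_fold T = 0"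
proof -
  obtain i k where i: "Suc i < length T"
    and k: "k \<in> {1..card (T ! Suc i)}" "entry (T ! Suc i) k < entry (T ! i) k"
    using assms(2) by (auto simp: semistandard_def not_le)
  let ?C = "T ! i" and ?D = "T ! Suc i"
  obtain P S where T_eq: "T = P @ ?C # ?D # S"
    using id_take_nth_drop[of i T] Cons_nth_drop_Suc[of "Suc i" T] i by (metis Suc_lessD)
  have "tableau n (P @ ?C # ?D # S)" using T by (subst (asm) T_eq)
  then have "?C \<in> cols n (card ?C)" "?D \<in> cols n (card ?D)" "card ?D \<le> card ?C"
    by (simp_all add: tableau_append tableau_Cons subset_in_cols)
  then have "column_comp ?C (Psi_fold (?D # S)) = 0"
    unfolding Psi_fold_simps(2) using k by (rule column_comp_column_op_eq_0)
  then have "Psi_fold (?C # ?D # S) = 0"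
    by (simp add: Psi_fold_simps(2)[of ?C] column_op_def lmult_bar_perm.zero)
  then have "Psi_fold (P @ ?C # ?D # S) = 0" by (simp only: Psi_fold_append[of P] foldr_column_op_0)
  then show ?thesis using T_eq by simp
qed

section \<open>Highest weight tableaux\<close>

lemma Psi_fold_highest_weight:
  "tableau n T \<Longrightarrow> highest_weight T \<Longrightarrow> Psi_fold T = one_lam n (shape T)"
proof (induction T)
  case Nil
  then show ?case by (simp add: Psi_fold_simps shape_def)
next
  case (Cons C T)
  have C: "C = {1..card C}" using Cons.prems(2) by (simp add: highest_weight_def)
  have "C \<subseteq> {1..n}" and card_le: "\<forall>D\<in>set T. card D \<le> card C" and T: "tableau n T"
    using Cons.prems(1) by (simp_all add: tableau_Cons)
  then have uC: "uC n C = id"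
    using uC_atLeastAtMost column_length_le subset_in_cols by (metis C)
  have "Psi_fold T = one_lam n (shape T)"
    using Cons.IH[OF T] Cons.prems(2) by (simp add: highest_weight_def)
  then have "column_comp C (Psi_fold T) = one_lam n (shape (C # T))"
    by (simp add: column_comp_def one_lam_def stab_shape_Cons[OF card_le] uC fun_eq_iff)
  then show ?case
    by (simp only: Psi_fold_simps column_op_def uC lmult_bar_perm_id one_lam_in_hecke)
qed

section \<open>The recursion\<close>

lemma lmult_bar_one_lam:
  assumes j: "j \<in> {1..<n}" and lam: "lam j = lam (Suc j)"
  shows "lmult_bar j (one_lam n lam) = one_lam n lam"
proof (rule hecke_eqI[where n = n])
  fix v assume "v \<in> perms n"
  then show "lmult_bar j (one_lam n lam) v = one_lam n lam v"
    using sgen_comp_in_stab_iff[of j n lam v, OF assms] j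
    by (auto simp: lmult_bar_def lmult_apply one_lam_def)
qed simp_all

definition sign_change_sum :: "nat \<Rightarrow> nat set list \<Rightarrow> 'a hecke \<Rightarrow> 'a hecke" where
  "sign_change_sum j T x = (\<Sum>k\<in>sign_changes j T.
    hscale (of_int (sigma j (colk T k)) * (1 - t)) (foldr column_op (Omega j k T) x))"

lemma sign_change_sum_Cons:
  assumes T: "T \<noteq> []"
  shows "sign_change_sum j (C # T) x =
    (if sigma j (hd T) * sigma j C = -1
     then hscale (of_int (sigma j (hd T)) * (1 - t))
       (column_op C (foldr column_op (map (scol j) T) x))
     else 0) + column_op C (sign_change_sum j T x)"
proof -
  let ?term = "\<lambda>T k.
    hscale (of_int (sigma j (colk T k)) * (1 - t)) (foldr column_op (Omega j k T) x)"
  have last_term: "?term (C # T) (length T) = hscale (of_int (sigma j (hd T)) * (1 - t))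
      (column_op C (foldr column_op (map (scol j) T) x))"
    using T
    by (simp add: colk_Cons colk_length Omega_Cons Omega_length Suc_leI One_nat_def
        del: hscale_apply)
  have "column_op C (sign_change_sum j T x) = (\<Sum>k\<in>sign_changes j T. ?term (C # T) k)"
    unfolding sign_change_sum_def column_op.sum
    by (intro sum.cong refl)
       (auto dest!: sign_changesD simp: column_op.scale colk_Cons Omega_Cons)
  moreover have "length T \<notin> sign_changes j T" using sign_changesD by blast
  ultimately show ?thesis
    unfolding last_term[symmetric]
    by (simp add: sign_change_sum_def sign_changes_Cons[OF T] finite_sign_changes del: hscale_apply)
qed

lemma foldr_column_op_recursion:
  assumes j: "j \<in> {1..<n}" and x: "lmult_bar j x = x"
    and T: "T \<noteq> []" "set T \<subseteq> Pow {1..n}" "sigma j (last T) = 1"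
  shows "foldr column_op T x =
    signed_lmult (sigma j (hd T)) j (foldr column_op (map (scol j) T) x) + sign_change_sum j T x"
  using T
proof (induction T rule: list_nonempty_induct)
  case (single C)
  then have "column_op C (lmult_bar j x) = lmult_bar j (column_op (scol j C) x)"
    using column_op_signed_lmult[OF subset_in_cols j, of C x] by (simp add: signed_lmult_def)
  then show ?case
    using single x by (simp add: signed_lmult_def sign_change_sum_def sign_changes_def)
next
  case (cons C T)
  let ?y = "foldr column_op (map (scol j) T) x"
  let ?switch = "if sigma j (hd T) * sigma j C = -1
    then hscale (of_int (sigma j (hd T)) * (1 - t)) (column_op C ?y) else 0"
  have C: "C \<in> cols n (card C)" using cons.prems by (simp add: subset_in_cols)
  have "foldr column_op T x = signed_lmult (sigma j (hd T)) j ?y + sign_change_sum j T x"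
    using cons.prems cons.hyps by (intro cons.IH) simp_all
  then have "foldr column_op (C # T) x
      = column_op C (signed_lmult (sigma j (hd T)) j ?y) + column_op C (sign_change_sum j T x)"
    by (simp only: foldr.simps o_apply column_op.add)
  also have "\<dots> = signed_lmult (sigma j C) j (column_op (scol j C) ?y)
      + (?switch + column_op C (sign_change_sum j T x))"
    by (simp only: column_op_signed_lmult_switch[OF C j] add.assoc)
  also have "\<dots> = signed_lmult (sigma j C) j (column_op (scol j C) ?y) + sign_change_sum j (C # T) x"
    by (simp only: sign_change_sum_Cons[OF cons.hyps])
  finally show ?case by simp
qed

lemma Psi_recursion:
  assumes tab: "tableau n (T @ X)" and T: "T \<noteq> []" and X: "highest_weight X"
    and semistd: "semistandard (T @ X)" and j: "j \<in> {1..<n}" "j \<notin> last T"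
  shows "Psi t n (T @ X) =
    (if j \<in> hd T \<and> Suc j \<notin> hd T
     then hmult t n (hbasis (sgen j)) (Psi t n (Omega j (length T) T @ X))
     else hscale t (hmult t n (hinv t n (hbasis (sgen j))) (Psi t n (Omega j (length T) T @ X))))
    + (\<Sum>k\<in>sign_changes j T.
        hscale (of_int (sigma j (colk T k)) * (1 - t)) (Psi t n (Omega j k T @ X)))"
proof -
  have columns: "set T \<subseteq> Pow {1..n}" "set X \<subseteq> Pow {1..n}" and "tableau n X"
    using tab by (auto simp: tableau_def sorted_wrt_append)
  have Psi: "Psi t n (S @ X) = foldr column_op S (Psi_fold X)"
    if "S \<noteq> []" "set S \<subseteq> Pow {1..n}" for S
    using Psi_eq_Psi_fold[of "S @ X"] that columns(2) by (simp add: Psi_fold_append)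
  have Psi_Omega: "Psi t n (Omega j k T @ X) = foldr column_op (Omega j k T) (Psi_fold X)" for k
    using T Omega_columns[OF columns(1) j(1)] by (intro Psi) simp_all
  have "lmult_bar j (Psi_fold X) = Psi_fold X"
    unfolding Psi_fold_highest_weight[OF \<open>tableau n X\<close> X]
    using shape_eq_if_semistandard[OF tab T X semistd _ j(2)] j(1)
    by (intro lmult_bar_one_lam) simp_all
  then have "Psi t n (T @ X) = signed_lmult (sigma j (hd T)) j (Psi t n (Omega j (length T) T @ X))
    + sign_change_sum j T (Psi_fold X)"
    unfolding Psi_Omega Psi[OF T columns(1)] unfolding Omega_length
    using j T columns(1) by (intro foldr_column_op_recursion) (simp_all add: sigma_def)
  moreover have "Psi t n (Omega j (length T) T @ X) \<in> hecke n" by (simp add: Psi_Omega)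
  ultimately show ?thesis
    by (simp only: signed_lmult_sigma[OF j(1)] sign_change_sum_def Psi_Omega)
qed

end

theorem theorem6p2:
  fixes t :: "'a::comm_ring_1" and n :: nat and T :: "nat set list"
  assumes "t dvd 1" and "1 \<le> n" and "is_tab n T"
  shows "(\<not> semistandard T \<longrightarrow> Psi t n T = hzero)
    \<and> (highest_weight T \<longrightarrow> Psi t n T = one_lam n (shape T))
    \<and> (\<forall>mu j. is_partition n mu \<and> nparts n mu \<le> card (last T)
          \<and> semistandard (T @ T0 n mu) \<and> j \<in> {1..n - 1} \<and> j \<notin> last T \<and> Suc j \<in> last T
        \<longrightarrow> Psi t n (T @ T0 n mu) =
            hadd (if j \<in> hd T \<and> Suc j \<notin> hd T
                  then hmult t n (hbasis (sgen j)) (Psi t n (Omega j (length T) T @ T0 n mu))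
                  else hscale t (hmult t n (hinv t n (hbasis (sgen j)))
                          (Psi t n (Omega j (length T) T @ T0 n mu))))
              (hsum (\<lambda>k. hscale (of_int (sigma j (colk T k)) * (1 - t))
                        (Psi t n (Omega j k T @ T0 n mu)))
                 {k \<in> {1..<length T}. sigma j (colk T k) * sigma j (colk T (Suc k)) = -1}))"
proof -
  interpret unit_hecke_algebra t n using assms(1) by unfold_locales
  have tab: "tableau n T" "T \<noteq> []" and Psi: "Psi t n T = Psi_fold T"
    using assms(3) by (auto simp: is_tab_def tableau_def intro!: Psi_eq_Psi_fold)
  show ?thesis
    unfolding sign_changes_def[symmetric] hadd_eq_plus hsum_eq_sum hzero_eq_0
  proof (intro conjI allI impI)
    show "Psi t n T = 0" if "\<not> semistandard T"
      using Psi_fold_not_semistandard[OF tab(1) that] by (simp only: Psi)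
    show "Psi t n T = one_lam n (shape T)" if "highest_weight T"
      using Psi_fold_highest_weight[OF tab(1) that] by (simp only: Psi)
  qed (use assms(2) in \<open>intro Psi_recursion tableau_append_T0[OF assms(3)] tab(2) highest_weight_T0;
      auto\<close>)
qed

end
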